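(* Let $p$ be an odd prime and let $0<\alpha\le1$ be fixed. There exist functions $a(n),c(n)$, depending only on $p$ and $\alpha$ and tending to $0$ as $n\to\infty$, such that the following holds. Let $f:\mathbb{F}_{p^n}\to[0,1]$ satisfy $\mathbb{E}(f)\ge\alpha$ and suppose $\Lambda_3(f)$ is minimal among all functions $f':\mathbb{F}_{p^n}\to[0,1]$ with $\mathbb{E}(f')\ge\alpha$. Then there exist a subgroup (subspace) $W\le\mathbb{F}_{p^n}$ with $\dim W\ge n-a(n)\,n$ and a function $h:\mathbb{F}_{p^n}\to\{0,1\}$ which is constant on cosets of $W$ (i.e. $h(x)=h(x+w)$ for all $x\in\mathbb{F}_{p^n}$, $w\in W$) such that $$\mathbb{E}(|f(m)-h(m)|)\le c(n).$$ (In the paper's notation: $\dim W=n-o(n)$ and $\mathbb{E}(|f-h|)=o(1)$.)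
   Context: $\mathbb{F}_{p^n}$ is regarded as an $n$-dimensional vector space over $\mathbb{F}_p$. For $g:\mathbb{F}_{p^n}\to\mathbb{C}$, $\mathbb{E}(g)=p^{-n}\sum_{m\in\mathbb{F}_{p^n}} g(m)$. For $f:\mathbb{F}_{p^n}\to[0,1]$, $\Lambda_3(f)=p^{-2n}\sum_{m,d\in\mathbb{F}_{p^n}} f(m)f(m+d)f(m+2d)$. *)

theory Defs
  imports "HOL-Analysis.Analysis"
begin

text \<open>The field with p^n elements, viewed as the n-dimensional vector space over F_p,
  is modelled as coordinate vectors: functions nat to nat with entries in 0..p-1 at
  indices below n and 0 elsewhere; addition is coordinatewise modulo p.\<close>

definition Fpn :: "nat \<Rightarrow> nat \<Rightarrow> (nat \<Rightarrow> nat) set" where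
  "Fpn p n = {v. \<forall>i. (i < n \<longrightarrow> v i < p) \<and> (n \<le> i \<longrightarrow> v i = 0)}"

definition vadd :: "nat \<Rightarrow> (nat \<Rightarrow> nat) \<Rightarrow> (nat \<Rightarrow> nat) \<Rightarrow> (nat \<Rightarrow> nat)" where
  "vadd p v w = (\<lambda>i. (v i + w i) mod p)"

definition is_subgroup :: "nat \<Rightarrow> nat \<Rightarrow> (nat \<Rightarrow> nat) set \<Rightarrow> bool" where
  "is_subgroup p n W \<longleftrightarrow> W \<subseteq> Fpn p n \<and> (\<lambda>_. 0) \<in> W \<and>
     (\<forall>v\<in>W. \<forall>w\<in>W. vadd p v w \<in> W)"

definition Ex :: "nat \<Rightarrow> nat \<Rightarrow> ((nat \<Rightarrow> nat) \<Rightarrow> real) \<Rightarrow> real" where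
  "Ex p n g = (\<Sum>m\<in>Fpn p n. g m) / real p ^ n"

definition Lambda3 :: "nat \<Rightarrow> nat \<Rightarrow> ((nat \<Rightarrow> nat) \<Rightarrow> real) \<Rightarrow> real" where
  "Lambda3 p n f = (\<Sum>m\<in>Fpn p n. \<Sum>d\<in>Fpn p n.
      f m * f (vadd p m d) * f (vadd p m (vadd p d d))) / real p ^ (2 * n)"

end

theory Submission
  imports Defs "HOL-Number_Theory.Cong"
begin

text \<open>Let f be a minimizer, W the annihilator of its large spectrum and g the average of f over the
  cosets of W. Since f - g has no large Fourier coefficient, g and f have almost the same
  number of progressions. Put u = min g (1 - g), and pick a coordinate i that does not vanish on W.
  Then g(x) + u(x) (1/p - [x i = 0]) is again an admissible competitor, and averaging over W
  shows that its progression count is that of g minus a fixed multiple of that of u. By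
  minimality u has few progressions, so u has small mean by the Roth--Meshulam theorem in its
  counting form, which follows by Green's energy increment. For h the rounding of g to 0 or 1, the
  mean of u equals the mean of |f - h|.\<close>

text \<open>The perturbation identity is exact only for functions constant on cosets of W, while
  minimality speaks of f. The comparison therefore runs through g and costs the difference between
  the counts of f and g, which the gain has to beat. When the start and the difference of a
  progression are shifted at random along W, the i-th coordinates of any two of its terms become
  independent, so a mean-zero perturbation contributes nothing of first or second order in u. What
  is left is cubic, and the profile 1/p - [y = 0] makes its sign negative. The gain is thus a
  multiple of the progression count of u, and if u has mean at least \<epsilon>, that count is at
  least a proportion depending on p and \<epsilon> only. The Fourier threshold \<delta> is chosen
  after this proportion, and W has codimension at most 1/\<delta>^2 whatever n is. A codimension
  bounded for each fixed \<epsilon> becomes o(n) when \<epsilon> shrinks slowly with n.\<close>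

lemma prod_diff_bound:
  fixes a b c x y z :: real
  assumes "0 \<le> a" "a \<le> 1" "0 \<le> b" "b \<le> 1" "0 \<le> c" "c \<le> 1"
    and "0 \<le> x" "x \<le> 1" "0 \<le> y" "y \<le> 1" "0 \<le> z" "z \<le> 1"
  shows "x * y * z - (\<bar>a - x\<bar> + \<bar>b - y\<bar> + \<bar>c - z\<bar>) \<le> a * b * c"
proof -
  \<comment> \<open>Factors are exchanged one at a time; the two accompanying factors lie in
    [0, 1].\<close>
  have "x * y * z - a * b * c = (x - a) * (y * z) + (y - b) * (a * z) + (z - c) * (a * b)"
    by (simp add: algebra_simps)
  moreover have "u * v \<le> \<bar>u\<bar>" if "0 \<le> v" "v \<le> 1" for u v :: real
    using mult_left_le[of v "\<bar>u\<bar>"] mult_right_mono[of u "\<bar>u\<bar>" v] that by linarith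
  from this[of "y * z" "x - a"] this[of "a * z" "y - b"] this[of "a * b" "z - c"]
  have "(x - a) * (y * z) \<le> \<bar>x - a\<bar>" "(y - b) * (a * z) \<le> \<bar>y - b\<bar>" "(z - c) * (a * b) \<le> \<bar>z - c\<bar>"
    using assms by (simp_all add: mult_le_one)
  ultimately show ?thesis by linarith
qed

text \<open>Turns thresholds "for each e, all large n" into one rate: \<open>c n\<close> is the
  infimum of the admissible errors at n. The infimum need not be admissible itself, so 1/(n+1) is
  added.\<close>

lemma exists_null_sequence:
  fixes Q :: "nat \<Rightarrow> real \<Rightarrow> bool"
  assumes "\<And>n. Q n 1"
    and mono: "\<And>n e e'. Q n e \<Longrightarrow> e \<le> e' \<Longrightarrow> Q n e'"
    and ev: "\<And>e. e > 0 \<Longrightarrow> \<forall>\<^sub>F n in sequentially. Q n e"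
  shows "\<exists>c. c \<longlonglongrightarrow> 0 \<and> (\<forall>n. Q n (c n))"
proof -
  define S where "S n = {e. 0 \<le> e \<and> Q n e}" for n
  define c where "c n = Inf (S n) + 1 / real (Suc n)" for n
  have ne: "S n \<noteq> {}" for n using assms(1)[of n] unfolding S_def by (auto intro!: exI[of _ 1])
  have bdd: "bdd_below (S n)" for n unfolding S_def by (auto intro!: bdd_belowI[of _ 0])
  have nonneg: "0 \<le> Inf (S n)" for n using ne[of n] by (auto intro!: cInf_greatest simp: S_def)
  have "Q n (c n)" for n
  proof -
    have "Inf (S n) < c n" by (simp add: c_def)
    then obtain e where "e \<in> S n" "e < c n" using cInf_lessD[OF ne] by blast
    then show ?thesis using mono[of n e] by (auto simp: S_def)
  qed
  moreover have "(\<lambda>n. Inf (S n)) \<longlonglongrightarrow> 0"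
  proof (rule LIMSEQ_I)
    fix r :: real assume "0 < r"
    then obtain N where N: "\<And>n. n \<ge> N \<Longrightarrow> Q n (r / 2)"
      using ev[of "r / 2"] by (auto simp: eventually_sequentially)
    have "norm (Inf (S n) - 0) < r" if "n \<ge> N" for n
    proof -
      have "r / 2 \<in> S n" using N[OF that] \<open>0 < r\<close> by (simp add: S_def)
      then have "Inf (S n) \<le> r / 2" using bdd by (intro cInf_lower)
      then show ?thesis using nonneg[of n] \<open>0 < r\<close> by simp
    qed
    then show "\<exists>no. \<forall>n\<ge>no. norm (Inf (S n) - 0) < r" by blast
  qed
  then have "c \<longlonglongrightarrow> 0"
    unfolding c_def using tendsto_add[OF _ LIMSEQ_inverse_real_of_nat] by (fastforce simp: inverse_eq_divide)
  ultimately show ?thesis by blast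
qed

text \<open>One factor is bounded by its supremum, the other two by their second moments. As both
  moments have the same bound M, ab <= (a^2 + b^2)/2 replaces Cauchy-Schwarz and no square roots
  occur.\<close>

lemma sum_norm_triple_le:
  fixes A B C :: "'a \<Rightarrow> complex"
  assumes "\<And>r. r \<in> S \<Longrightarrow> norm (C r) \<le> K" "0 \<le> K"
    "(\<Sum>r\<in>S. (norm (A r))\<^sup>2) \<le> M" "(\<Sum>r\<in>S. (norm (B r))\<^sup>2) \<le> M"
  shows "norm (\<Sum>r\<in>S. A r * B r * C r) \<le> K * M"
proof -
  have "norm (\<Sum>r\<in>S. A r * B r * C r) \<le> (\<Sum>r\<in>S. norm (A r * B r * C r))"
    by (rule norm_sum)
  also have "\<dots> \<le> (\<Sum>r\<in>S. K * (((norm (A r))\<^sup>2 + (norm (B r))\<^sup>2) / 2))"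
  proof (rule sum_mono)
    fix r assume "r \<in> S"
    have "norm (A r) * norm (B r) \<le> ((norm (A r))\<^sup>2 + (norm (B r))\<^sup>2) / 2"
      using sum_squares_bound[of "norm (A r)" "norm (B r)"] by simp
    then have "norm (A r) * norm (B r) * norm (C r) \<le> ((norm (A r))\<^sup>2 + (norm (B r))\<^sup>2) / 2 * K"
      using assms(1)[OF \<open>r \<in> S\<close>] by (intro mult_mono) auto
    then show "norm (A r * B r * C r) \<le> K * (((norm (A r))\<^sup>2 + (norm (B r))\<^sup>2) / 2)"
      by (simp add: norm_mult mult.commute)
  qed
  also have "\<dots> = K * (((\<Sum>r\<in>S. (norm (A r))\<^sup>2) + (\<Sum>r\<in>S. (norm (B r))\<^sup>2)) / 2)"
    by (simp add: sum_distrib_left sum.distrib[symmetric] sum_divide_distrib distrib_left)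
  also have "\<dots> \<le> K * M"
    using assms by (intro mult_left_mono) auto
  finally show ?thesis .
qed

section \<open>The space F_p^n: translations and doubling\<close>

locale odd_prime =
  fixes p :: nat
  assumes prime: "prime p" and odd: "odd p"
begin

lemma p_pos: "p > 0" and p_gt_2: "p > 2"
  using prime odd prime_gt_1_nat[OF prime] by (auto simp: prime_gt_0_nat) (metis even_numeral le_neq_implies_less Suc_leI numeral_2_eq_2)

abbreviation V where "V n \<equiv> Fpn p n"

abbreviation vplus (infixl "\<oplus>" 65) where "x \<oplus> y \<equiv> vadd p x y"

definition smul :: "nat \<Rightarrow> (nat \<Rightarrow> nat) \<Rightarrow> nat \<Rightarrow> nat" where
  "smul s x = (\<lambda>i. (s * x i) mod p)"

lemma VD: "x \<in> V n \<Longrightarrow> x i < p" and VD0: "x \<in> V n \<Longrightarrow> n \<le> i \<Longrightarrow> x i = 0"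
  using p_pos by (cases "i < n"; auto simp: Fpn_def)+

lemma zero_V [simp]: "(\<lambda>_. 0) \<in> V n"
  using p_pos by (simp add: Fpn_def)

lemma vadd_V [simp]: "x \<in> V n \<Longrightarrow> y \<in> V n \<Longrightarrow> x \<oplus> y \<in> V n"
  using p_pos by (simp add: Fpn_def vadd_def)

lemma smul_V [simp]: "x \<in> V n \<Longrightarrow> smul s x \<in> V n"
  using p_pos by (simp add: Fpn_def smul_def)

lemma vadd_assoc: "x \<oplus> y \<oplus> z = x \<oplus> (y \<oplus> z)"
  by (simp add: vadd_def mod_simps add.assoc)

lemma vadd_commute: "x \<oplus> y = y \<oplus> x"
  by (simp add: vadd_def add.commute)

lemma vadd_left_commute: "x \<oplus> (y \<oplus> z) = y \<oplus> (x \<oplus> z)"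
  by (metis vadd_assoc vadd_commute)

lemmas vadd_ac = vadd_assoc vadd_commute vadd_left_commute

lemma vadd_smul: "smul s x \<oplus> x = smul (Suc s) x"
  by (simp add: vadd_def smul_def mod_simps add.commute)

text \<open>Coordinates of members of \<open>V n\<close> are reduced, so congruence modulo p is
  equality. Cancellation takes the place of subtraction.\<close>

lemma vadd_cancel:
  assumes "x \<in> V n" "y \<in> V n" "w \<oplus> x = w \<oplus> y"
  shows "x = y"
proof
  fix i
  have "(w i + x i) mod p = (w i + y i) mod p"
    using assms(3) unfolding vadd_def by meson
  then have "[x i = y i] (mod p)"
    by (metis cong_add_lcancel_nat unique_euclidean_semiring_class.cong_def)
  then show "x i = y i"
    using assms VD by (metis cong_less_modulus_unique_nat)
qed

lemma finite_V [simp]: "finite (V n)" and card_V: "card (V n) = p ^ n"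
proof -
  have "bij_betw (\<lambda>x. restrict x {..<n}) (V n) ({..<n} \<rightarrow>\<^sub>E {..<p})"
  proof (rule bij_betwI[where g = "\<lambda>y i. if i < n then y i else 0"])
    show "(\<lambda>x. restrict x {..<n}) \<in> V n \<rightarrow> {..<n} \<rightarrow>\<^sub>E {..<p}"
      by (auto simp: VD)
  next
    show "(\<lambda>y i. if i < n then y i else 0) \<in> ({..<n} \<rightarrow>\<^sub>E {..<p}) \<rightarrow> V n"
      by (auto simp: Fpn_def PiE_iff)
  next
    fix x assume "x \<in> V n"
    then show "(\<lambda>i. if i < n then restrict x {..<n} i else 0) = x"
      by (auto simp: fun_eq_iff VD0)
  next
    fix y assume "y \<in> {..<n} \<rightarrow>\<^sub>E {..<p}"
    then show "restrict (\<lambda>i. if i < n then y i else 0) {..<n} = y"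
      by (auto simp: fun_eq_iff PiE_iff extensional_def)
  qed
  then show "finite (V n)" "card (V n) = p ^ n"
    using bij_betw_finite bij_betw_same_card finite_PiE[of "{..<n}" "\<lambda>_. {..<p}"]
    by (fastforce simp: card_funcsetE)+
qed

lemma vadd_bij:
  assumes "w \<in> V n"
  shows "bij_betw (\<lambda>x. w \<oplus> x) (V n) (V n)"
proof -
  have "inj_on (\<lambda>x. w \<oplus> x) (V n)" by (rule inj_onI) (rule vadd_cancel)
  moreover have "(\<lambda>x. w \<oplus> x) ` V n \<subseteq> V n" using assms by auto
  ultimately show ?thesis using endo_inj_surj finite_V unfolding bij_betw_def by blast
qed

lemma sum_shift:
  assumes "w \<in> V n"
  shows "(\<Sum>x\<in>V n. f (x \<oplus> w)) = (\<Sum>x\<in>V n. f x)"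
  using sum.reindex_bij_betw[OF vadd_bij[OF assms], of f] by (simp add: vadd_commute)

text \<open>2 is a unit modulo the odd prime p. This matters because the middle term of a
  progression enters the Fourier expansion with doubled frequency.\<close>

lemma double_inj: "inj_on (\<lambda>x. x \<oplus> x) (V n)"
proof (rule inj_onI, rule ext)
  fix x y i
  assume "x \<in> V n" "y \<in> V n" "x \<oplus> x = y \<oplus> y"
  then have "(2 * x i) mod p = (2 * y i) mod p"
    unfolding vadd_def by (metis mult_2)
  moreover have "coprime 2 p" using odd by simp
  ultimately have "[x i = y i] (mod p)"
    by (metis cong_mult_lcancel_nat unique_euclidean_semiring_class.cong_def)
  then show "x i = y i"
    using \<open>x \<in> V n\<close> \<open>y \<in> V n\<close> VD by (metis cong_less_modulus_unique_nat)
qed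

subsection \<open>Characters\<close>

definition \<omega> :: complex where "\<omega> = cis (2 * pi / real p)"

text \<open>The additive character e(r.x/p). It is symmetric in r and x, so the dual group is
  identified with \<open>V n\<close> itself.\<close>

definition chr :: "nat \<Rightarrow> (nat \<Rightarrow> nat) \<Rightarrow> (nat \<Rightarrow> nat) \<Rightarrow> complex" where
  "chr n r x = (\<Prod>i<n. \<omega> ^ (r i * x i))"

lemma omega_pow_p [simp]: "\<omega> ^ p = 1"
  using p_pos by (simp add: \<omega>_def) (subst Complex.DeMoivre, simp)

lemma omega_mod: "\<omega> ^ (k mod p) = \<omega> ^ k"
proof -
  have "\<omega> ^ k = \<omega> ^ (p * (k div p) + k mod p)" by simp
  also have "\<dots> = \<omega> ^ (k mod p)" by (simp only: power_add power_mult) simp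
  finally show ?thesis by simp
qed

lemma norm_omega [simp]: "norm \<omega> = 1" by (simp add: \<omega>_def)

lemma norm_chr [simp]: "norm (chr n r x) = 1"
  by (simp add: chr_def prod_norm[symmetric] norm_power)

lemma chr_cnj: "chr n r x * cnj (chr n r x) = 1"
  by (simp add: complex_norm_square[symmetric])

lemma chr_add: "chr n r (x \<oplus> y) = chr n r x * chr n r y"
proof -
  have "\<omega> ^ (a * ((b + c) mod p)) = \<omega> ^ (a * b) * \<omega> ^ (a * c)" for a b c
    by (metis omega_mod mod_mult_right_eq distrib_left power_add)
  then show ?thesis by (simp add: chr_def vadd_def prod.distrib)
qed

lemma chr_sym: "chr n r x = chr n x r"
  by (simp add: chr_def mult.commute)

lemma chr_add_left: "chr n (r \<oplus> s) x = chr n r x * chr n s x"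
  by (metis chr_add chr_sym)

lemma chr_smul: "chr n r (smul s x) = chr n r x ^ s"
proof (induction s)
  case 0
  then show ?case by (simp add: smul_def chr_def)
next
  case (Suc s)
  then show ?case by (simp add: vadd_smul[symmetric] chr_add)
qed

lemma chr_pow_p: "chr n r x ^ p = 1"
  by (simp add: chr_def prod_power_distrib power_mult[symmetric] mult.commute[of _ p])
     (simp add: power_mult)

lemma omega_inj:
  assumes "a < p" "b < p" "\<omega> ^ a = \<omega> ^ b"
  shows "a = b"
proof -
  have "cis (2 * pi * real a / real p) = cis (2 * pi * real b / real p)"
    using assms(3) by (simp add: \<omega>_def Complex.DeMoivre mult_ac)
  then show ?thesis
    using inj_onD[OF bij_betw_imp_inj_on[OF Complex.bij_betw_roots_unity[OF p_pos]], of a b] assms(1,2) by simp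
qed

text \<open>If a and b differ in coordinate i, translating r by the i-th unit vector multiplies the
  sum by \<open>\<omega> ^ a i * cnj (\<omega> ^ b i)\<close>, which is not 1; so the sum
  vanishes.\<close>

lemma orthogonality:
  assumes "a \<in> V n" "b \<in> V n"
  shows "(\<Sum>r\<in>V n. chr n r a * cnj (chr n r b)) = (if a = b then of_nat (p ^ n) else 0)"
proof (cases "a = b")
  case True
  then show ?thesis by (simp add: chr_cnj card_V)
next
  case False
  then obtain i where i: "a i \<noteq> b i" by blast
  then have "i < n" using assms VD0 by (metis not_le)
  define e where "e = (\<lambda>j. if j = i then 1 else 0 :: nat)"
  have e: "e \<in> V n" using \<open>i < n\<close> p_gt_2 by (auto simp: e_def Fpn_def)
  have ce: "chr n e x = \<omega> ^ x i" for x
  proof -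
    have "chr n e x = (\<Prod>j<n. if j = i then \<omega> ^ x i else 1)"
      unfolding chr_def e_def by (intro prod.cong) auto
    then show ?thesis using \<open>i < n\<close> by simp
  qed
  define S where "S = (\<Sum>r\<in>V n. chr n r a * cnj (chr n r b))"
  have "S = (\<Sum>r\<in>V n. chr n (r \<oplus> e) a * cnj (chr n (r \<oplus> e) b))"
    unfolding S_def by (rule sum_shift[OF e, symmetric])
  also have "\<dots> = (\<Sum>r\<in>V n. chr n r a * cnj (chr n r b) * (\<omega> ^ a i * cnj (\<omega> ^ b i)))"
    by (simp add: chr_add_left ce mult_ac)
  also have "\<dots> = S * (\<omega> ^ a i * cnj (\<omega> ^ b i))"
    unfolding S_def by (simp only: sum_distrib_right)
  finally have S: "S = S * (\<omega> ^ a i * cnj (\<omega> ^ b i))" .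
  have "\<omega> ^ a i * cnj (\<omega> ^ b i) \<noteq> 1"
  proof
    assume "\<omega> ^ a i * cnj (\<omega> ^ b i) = 1"
    then have "\<omega> ^ a i * (cnj (\<omega> ^ b i) * \<omega> ^ b i) = \<omega> ^ b i" by (simp add: mult.assoc[symmetric] del: complex_cnj_power)
    moreover have "cnj (\<omega> ^ b i) * \<omega> ^ b i = 1"
      using complex_norm_square[of "\<omega> ^ b i"] by (simp add: norm_power mult.commute)
    ultimately have "\<omega> ^ a i = \<omega> ^ b i" by (simp del: complex_cnj_power)
    then show False using omega_inj assms VD i by metis
  qed
  then have "S = 0" using S by (metis mult_cancel_left1)
  then show ?thesis using False by (simp add: S_def)
qed

section \<open>The Fourier transform and the trilinear progression form\<close>

definition Fou :: "nat \<Rightarrow> ((nat \<Rightarrow> nat) \<Rightarrow> real) \<Rightarrow> (nat \<Rightarrow> nat) \<Rightarrow> complex" where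
  "Fou n f r = (\<Sum>x\<in>V n. of_real (f x) * chr n r x)"

text \<open>The unnormalised trilinear form behind \<open>Lambda3\<close>; separate arguments allow
  one function to be replaced at a time. A bounded function has transform at most p^n, which is why
  thresholds below are multiples of p^n.\<close>

definition T :: "nat \<Rightarrow> ((nat \<Rightarrow> nat) \<Rightarrow> real) \<Rightarrow> ((nat \<Rightarrow> nat) \<Rightarrow> real) \<Rightarrow> ((nat \<Rightarrow> nat) \<Rightarrow> real) \<Rightarrow> real" where
  "T n f g h = (\<Sum>m\<in>V n. \<Sum>d\<in>V n. f m * g (m \<oplus> d) * h (m \<oplus> (d \<oplus> d)))"

text \<open>Parseval along an injection \<psi>: the identity gives the usual form, doubling gives
  the second moment over the frequencies \<open>r \<oplus> r\<close>.\<close>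

lemma parseval_inj:
  assumes "inj_on \<psi> (V n)" "\<psi> ` V n \<subseteq> V n"
  shows "(\<Sum>r\<in>V n. (norm (\<Sum>x\<in>V n. of_real (f x) * chr n r (\<psi> x)))\<^sup>2) = real p ^ n * (\<Sum>x\<in>V n. (f x)\<^sup>2)"
proof -
  have "complex_of_real (\<Sum>r\<in>V n. (norm (\<Sum>x\<in>V n. of_real (f x) * chr n r (\<psi> x)))\<^sup>2)
    = (\<Sum>r\<in>V n. (\<Sum>x\<in>V n. of_real (f x) * chr n r (\<psi> x)) * cnj (\<Sum>x\<in>V n. of_real (f x) * chr n r (\<psi> x)))"
    by (simp only: of_real_sum complex_norm_square)
  also have "\<dots> = (\<Sum>r\<in>V n. \<Sum>x\<in>V n. \<Sum>y\<in>V n. of_real (f x * f y) * (chr n r (\<psi> x) * cnj (chr n r (\<psi> y))))"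
    by (simp add: sum_product mult_ac)
  also have "\<dots> = (\<Sum>x\<in>V n. \<Sum>r\<in>V n. \<Sum>y\<in>V n. of_real (f x * f y) * (chr n r (\<psi> x) * cnj (chr n r (\<psi> y))))"
    by (rule sum.swap)
  also have "\<dots> = (\<Sum>x\<in>V n. \<Sum>y\<in>V n. \<Sum>r\<in>V n. of_real (f x * f y) * (chr n r (\<psi> x) * cnj (chr n r (\<psi> y))))"
    by (intro sum.cong refl sum.swap)
  also have "\<dots> = (\<Sum>x\<in>V n. \<Sum>y\<in>V n. of_real (f x * f y) * (if x = y then of_nat (p ^ n) else 0))"
    unfolding sum_distrib_left[symmetric]
    using assms by (intro sum.cong refl arg_cong2[of _ _ _ _ "(*)"]) (auto simp: orthogonality image_subset_iff dest: inj_onD)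
  also have "\<dots> = (\<Sum>x\<in>V n. \<Sum>y\<in>V n. if x = y then of_real (f x * f y) * of_nat (p ^ n) else 0)"
    by (intro sum.cong refl) auto
  also have "\<dots> = of_real (real p ^ n * (\<Sum>x\<in>V n. (f x)\<^sup>2))"
    by (simp add: sum_distrib_left power2_eq_square mult_ac)
  finally show ?thesis using of_real_eq_iff by blast
qed

lemma sum_norm_sq_le:
  assumes "inj_on \<psi> (V n)" "\<psi> ` V n \<subseteq> V n" "\<And>x. x \<in> V n \<Longrightarrow> \<bar>f x\<bar> \<le> 1"
  shows "(\<Sum>r\<in>V n. (norm (\<Sum>x\<in>V n. of_real (f x) * chr n r (\<psi> x)))\<^sup>2) \<le> real p ^ n * real p ^ n"
proof -
  have "(\<Sum>x\<in>V n. (f x)\<^sup>2) \<le> (\<Sum>x\<in>V n. 1)"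
    using assms(3) by (intro sum_mono) (simp add: abs_square_le_1)
  then show ?thesis unfolding parseval_inj[OF assms(1,2)] by (simp add: card_V mult_left_mono)
qed

lemma Fou_sum_le:
  assumes "\<And>x. x \<in> V n \<Longrightarrow> \<bar>f x\<bar> \<le> 1"
  shows "(\<Sum>r\<in>V n. (norm (Fou n f r))\<^sup>2) \<le> real p ^ n * real p ^ n"
  using sum_norm_sq_le[of id n f] assms by (simp add: Fou_def)

lemma Fou_double: "Fou n f (r \<oplus> r) = (\<Sum>x\<in>V n. of_real (f x) * chr n r (x \<oplus> x))"
  by (simp add: Fou_def chr_add chr_add_left)

lemma Fou_double_sum_le:
  assumes "\<And>x. x \<in> V n \<Longrightarrow> \<bar>f x\<bar> \<le> 1"
  shows "(\<Sum>r\<in>V n. (norm (Fou n f (r \<oplus> r)))\<^sup>2) \<le> real p ^ n * real p ^ n"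
  unfolding Fou_double using assms by (intro sum_norm_sq_le[OF double_inj]) auto

text \<open>Points x, y, z form a progression in this order exactly when x + z = 2y, and summing
  characters over r detects this equation.\<close>

lemma T_fourier:
  "of_real (real p ^ n * T n f g h) = (\<Sum>r\<in>V n. Fou n f r * cnj (Fou n g (r \<oplus> r)) * Fou n h r)"
proof -
  let ?c = "\<lambda>x y z. complex_of_real (f x * g y * h z)"
  have "(\<Sum>r\<in>V n. Fou n f r * cnj (Fou n g (r \<oplus> r)) * Fou n h r)
    = (\<Sum>r\<in>V n. \<Sum>x\<in>V n. \<Sum>y\<in>V n. \<Sum>z\<in>V n. ?c x y z * (chr n r (x \<oplus> z) * cnj (chr n r (y \<oplus> y))))"
    unfolding Fou_double unfolding Fou_def cnj_sum mult.assoc unfolding sum_product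
    by (intro sum.cong refl) (simp add: sum_distrib_left chr_add mult_ac)
  also have "\<dots> = (\<Sum>x\<in>V n. \<Sum>r\<in>V n. \<Sum>y\<in>V n. \<Sum>z\<in>V n. ?c x y z * (chr n r (x \<oplus> z) * cnj (chr n r (y \<oplus> y))))"
    by (rule sum.swap)
  also have "\<dots> = (\<Sum>x\<in>V n. \<Sum>y\<in>V n. \<Sum>r\<in>V n. \<Sum>z\<in>V n. ?c x y z * (chr n r (x \<oplus> z) * cnj (chr n r (y \<oplus> y))))"
    by (intro sum.cong refl sum.swap)
  also have "\<dots> = (\<Sum>x\<in>V n. \<Sum>y\<in>V n. \<Sum>z\<in>V n. \<Sum>r\<in>V n. ?c x y z * (chr n r (x \<oplus> z) * cnj (chr n r (y \<oplus> y))))"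
    by (intro sum.cong refl sum.swap)
  also have "\<dots> = (\<Sum>x\<in>V n. \<Sum>y\<in>V n. \<Sum>z\<in>V n. ?c x y z * (if x \<oplus> z = y \<oplus> y then of_nat (p ^ n) else 0))"
    unfolding sum_distrib_left[symmetric] by (intro sum.cong refl) (simp add: orthogonality)
  \<comment> \<open>With y = x + d, cancellation leaves z = x + 2d as the only surviving
    value.\<close>
  also have "\<dots> = (\<Sum>x\<in>V n. \<Sum>d\<in>V n. \<Sum>z\<in>V n. ?c x (x \<oplus> d) z * (if x \<oplus> z = (x \<oplus> d) \<oplus> (x \<oplus> d) then of_nat (p ^ n) else 0))"
    by (intro sum.cong refl sum.reindex_bij_betw[OF vadd_bij, symmetric])
  also have "\<dots> = (\<Sum>x\<in>V n. \<Sum>d\<in>V n. \<Sum>z\<in>V n. if z = x \<oplus> (d \<oplus> d) then ?c x (x \<oplus> d) (x \<oplus> (d \<oplus> d)) * of_nat (p ^ n) else 0)"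
  proof (intro sum.cong refl)
    fix x d z assume V: "x \<in> V n" "d \<in> V n" "z \<in> V n"
    have "(x \<oplus> d) \<oplus> (x \<oplus> d) = x \<oplus> (x \<oplus> (d \<oplus> d))" by (simp only: vadd_ac)
    then have "x \<oplus> z = (x \<oplus> d) \<oplus> (x \<oplus> d) \<longleftrightarrow> z = x \<oplus> (d \<oplus> d)"
      using vadd_cancel[of z n "x \<oplus> (d \<oplus> d)" x] V by auto
    then show "?c x (x \<oplus> d) z * (if x \<oplus> z = (x \<oplus> d) \<oplus> (x \<oplus> d) then of_nat (p ^ n) else 0)
      = (if z = x \<oplus> (d \<oplus> d) then ?c x (x \<oplus> d) (x \<oplus> (d \<oplus> d)) * of_nat (p ^ n) else 0)" by simp
  qed
  also have "\<dots> = (\<Sum>x\<in>V n. \<Sum>d\<in>V n. ?c x (x \<oplus> d) (x \<oplus> (d \<oplus> d)) * of_nat (p ^ n))"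
    by (intro sum.cong refl) (simp add: sum.delta)
  also have "\<dots> = of_real (real p ^ n * T n f g h)"
    unfolding T_def by (simp add: sum_distrib_left mult_ac)
  finally show ?thesis by simp
qed

text \<open>Reversal of progressions, read off from the symmetry of the Fourier formula in its outer
  functions. It lets the bound for the last slot serve for the first.\<close>

lemma T_rev: "T n f g h = T n h g f"
proof -
  have "complex_of_real (real p ^ n * T n f g h) = of_real (real p ^ n * T n h g f)"
    unfolding T_fourier by (simp add: mult_ac)
  then have "real p ^ n * T n f g h = real p ^ n * T n h g f" using of_real_eq_iff by blast
  then show ?thesis using p_pos by simp
qed

lemma T_le_Fou_right:
  assumes "\<And>x. x \<in> V n \<Longrightarrow> \<bar>f x\<bar> \<le> 1" "\<And>x. x \<in> V n \<Longrightarrow> \<bar>g x\<bar> \<le> 1"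
    and "\<And>r. r \<in> V n \<Longrightarrow> norm (Fou n h r) \<le> K" "0 \<le> K"
  shows "\<bar>T n f g h\<bar> \<le> K * real p ^ n"
proof -
  have "norm (complex_of_real (real p ^ n * T n f g h)) \<le> K * (real p ^ n * real p ^ n)"
    unfolding T_fourier using assms
    by (intro sum_norm_triple_le) (simp_all add: Fou_sum_le Fou_double_sum_le)
  then have "real p ^ n * \<bar>T n f g h\<bar> \<le> real p ^ n * (K * real p ^ n)"
    by (simp add: norm_mult norm_power abs_mult mult_ac)
  then show ?thesis using p_pos by simp
qed

text \<open>Here the supremum is taken at the doubled frequencies, and both outer functions are
  handled by Parseval.\<close>

lemma T_le_Fou_middle:
  assumes "\<And>x. x \<in> V n \<Longrightarrow> \<bar>f x\<bar> \<le> 1" "\<And>x. x \<in> V n \<Longrightarrow> \<bar>h x\<bar> \<le> 1"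
    and "\<And>r. r \<in> V n \<Longrightarrow> norm (Fou n g r) \<le> K" "0 \<le> K"
  shows "\<bar>T n f g h\<bar> \<le> K * real p ^ n"
proof -
  have "(\<Sum>r\<in>V n. Fou n f r * cnj (Fou n g (r \<oplus> r)) * Fou n h r)
    = (\<Sum>r\<in>V n. Fou n f r * Fou n h r * cnj (Fou n g (r \<oplus> r)))"
    by (simp add: mult_ac)
  moreover have "norm \<dots> \<le> K * (real p ^ n * real p ^ n)"
    using assms by (intro sum_norm_triple_le) (simp_all add: Fou_sum_le)
  ultimately have "norm (complex_of_real (real p ^ n * T n f g h)) \<le> K * (real p ^ n * real p ^ n)"
    unfolding T_fourier by simp
  then have "real p ^ n * \<bar>T n f g h\<bar> \<le> real p ^ n * (K * real p ^ n)"
    by (simp add: norm_mult norm_power abs_mult mult_ac)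
  then show ?thesis using p_pos by simp
qed

lemma T_diff: "T n f f f - T n g g g =
    T n (\<lambda>x. f x - g x) f f + T n g (\<lambda>x. f x - g x) f + T n g g (\<lambda>x. f x - g x)"
  unfolding T_def by (simp add: sum_subtractf[symmetric] sum.distrib[symmetric] algebra_simps)

lemma T_stable:
  assumes f: "\<And>x. x \<in> V n \<Longrightarrow> 0 \<le> f x \<and> f x \<le> 1" and g: "\<And>x. x \<in> V n \<Longrightarrow> 0 \<le> g x \<and> g x \<le> 1"
    and "\<And>r. r \<in> V n \<Longrightarrow> norm (Fou n (\<lambda>x. f x - g x) r) \<le> K" "0 \<le> K"
  shows "\<bar>T n f f f - T n g g g\<bar> \<le> 3 * K * real p ^ n"
proof -
  have f': "\<bar>f x\<bar> \<le> 1" if "x \<in> V n" for x using f[OF that] by simp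
  have g': "\<bar>g x\<bar> \<le> 1" if "x \<in> V n" for x using g[OF that] by simp
  have "\<bar>T n (\<lambda>x. f x - g x) f f\<bar> \<le> K * real p ^ n"
    unfolding T_rev[of n "\<lambda>x. f x - g x"] using f' assms(3,4) by (intro T_le_Fou_right)
  moreover have "\<bar>T n g (\<lambda>x. f x - g x) f\<bar> \<le> K * real p ^ n"
    using f' g' assms(3,4) by (intro T_le_Fou_middle)
  moreover have "\<bar>T n g g (\<lambda>x. f x - g x)\<bar> \<le> K * real p ^ n"
    using g' assms(3,4) by (intro T_le_Fou_right)
  ultimately show ?thesis unfolding T_diff by linarith
qed


subsection \<open>Averaging over annihilators\<close>

text \<open>Subgroups are given by the frequencies they annihilate: codimension is then controlled
  by \<open>card R\<close>, and the effect of averaging on Fourier coefficients is explicit.\<close>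

definition ann :: "nat \<Rightarrow> (nat \<Rightarrow> nat) set \<Rightarrow> (nat \<Rightarrow> nat) set" where
  "ann n R = {x \<in> V n. \<forall>r\<in>R. chr n r x = 1}"

definition avg :: "nat \<Rightarrow> (nat \<Rightarrow> nat) set \<Rightarrow> ((nat \<Rightarrow> nat) \<Rightarrow> real) \<Rightarrow> (nat \<Rightarrow> nat) \<Rightarrow> real" where
  "avg n R f x = (\<Sum>w\<in>ann n R. f (x \<oplus> w)) / real (card (ann n R))"

definition invariant :: "nat \<Rightarrow> (nat \<Rightarrow> nat) set \<Rightarrow> ((nat \<Rightarrow> nat) \<Rightarrow> real) \<Rightarrow> bool" where
  "invariant n R f \<longleftrightarrow> (\<forall>x\<in>V n. \<forall>w\<in>ann n R. f (x \<oplus> w) = f x)"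

lemma ann_V: "w \<in> ann n R \<Longrightarrow> w \<in> V n" by (simp add: ann_def)

lemma ann_zero: "(\<lambda>_. 0) \<in> ann n R" by (simp add: ann_def chr_def)

lemma ann_nonempty [simp]: "ann n R \<noteq> {}"
  using ann_zero by blast

lemma ann_add: "v \<in> ann n R \<Longrightarrow> w \<in> ann n R \<Longrightarrow> v \<oplus> w \<in> ann n R"
  by (simp add: ann_def chr_add)

lemma ann_smul: "w \<in> ann n R \<Longrightarrow> smul s w \<in> ann n R"
  by (simp add: ann_def chr_smul)

lemma ann_subgroup: "is_subgroup p n (ann n R)"
  unfolding is_subgroup_def using ann_V ann_zero ann_add by blast

lemma ann_finite [simp]: "finite (ann n R)"
  by (rule finite_subset[OF _ finite_V[of n]]) (auto simp: ann_def)

lemma ann_card_pos: "card (ann n R) > 0"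
  using ann_zero[of n R] by (auto simp: card_gt_0_iff)

lemma ann_mono: "R \<subseteq> R' \<Longrightarrow> ann n R' \<subseteq> ann n R"
  by (auto simp: ann_def)

lemma invariant_mono: "invariant n R f \<Longrightarrow> R \<subseteq> R' \<Longrightarrow> invariant n R' f"
  unfolding invariant_def using ann_mono by blast

text \<open>The characters in R jointly take at most p^|R| values on \<open>V n\<close>, and each
  fibre of this map is a translate of the annihilator.\<close>

lemma ann_card:
  assumes "finite R"
  shows "p ^ n \<le> p ^ card R * card (ann n R)"
proof -
  define g where "g x = restrict (\<lambda>r. chr n r x) R" for x
  have "g ` V n \<subseteq> (R \<rightarrow>\<^sub>E {z. z ^ p = 1})" by (auto simp: g_def chr_pow_p)
  moreover have fin: "finite (R \<rightarrow>\<^sub>E {z::complex. z ^ p = 1})"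
    using assms p_pos by (intro finite_PiE finite_roots_unity) auto
  moreover have "card (R \<rightarrow>\<^sub>E {z::complex. z ^ p = 1}) = p ^ card R"
    using assms p_pos by (simp add: card_funcsetE card_roots_unity_eq)
  ultimately have img: "card (g ` V n) \<le> p ^ card R" by (metis card_mono)
  have fib: "card {x \<in> V n. g x = y} \<le> card (ann n R)" if y: "y \<in> g ` V n" for y
  proof -
    obtain a where a: "a \<in> V n" "g a = y" using y by blast
    \<comment> \<open>The negative of a, which translates the fibre of a into the
      annihilator.\<close>
    define b where "b = smul (p - 1) a"
    have b: "b \<in> V n" using a by (simp add: b_def)
    have "chr n r b * chr n r a = 1" for r
    proof -
      have "chr n r b * chr n r a = chr n r a ^ (Suc (p - 1))" by (simp add: b_def chr_smul mult.commute)
      then show ?thesis using p_pos chr_pow_p by simp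
    qed
    moreover have "chr n r x = chr n r a" if "g x = y" "r \<in> R" for x r
      using that a(2) unfolding g_def by (metis restrict_apply')
    ultimately have "(\<lambda>x. b \<oplus> x) ` {x \<in> V n. g x = y} \<subseteq> ann n R"
      using b by (auto simp: ann_def chr_add)
    moreover have "inj_on (\<lambda>x. b \<oplus> x) {x \<in> V n. g x = y}"
      by (rule inj_onI) (auto dest: vadd_cancel)
    ultimately show ?thesis by (metis card_inj_on_le ann_finite)
  qed
  have "V n = (\<Union>y\<in>g ` V n. {x \<in> V n. g x = y})" by auto
  then have "p ^ n \<le> (\<Sum>y\<in>g ` V n. card {x \<in> V n. g x = y})"
    using card_UN_le[of "g ` V n" "\<lambda>y. {x \<in> V n. g x = y}"] by (simp add: card_V[symmetric])
  also have "\<dots> \<le> card (g ` V n) * card (ann n R)"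
    using sum_bounded_above[of "g ` V n" "\<lambda>y. card {x \<in> V n. g x = y}", OF fib] by simp
  also have "\<dots> \<le> p ^ card R * card (ann n R)" using img by (rule mult_right_mono) simp
  finally show ?thesis .
qed

lemma avg_invariant: "invariant n R (avg n R f)"
proof (unfold invariant_def, intro ballI)
  fix x w assume x: "x \<in> V n" and w: "w \<in> ann n R"
  have "inj_on (\<lambda>v. w \<oplus> v) (ann n R)" by (rule inj_onI) (auto dest: vadd_cancel ann_V)
  moreover have "(\<lambda>v. w \<oplus> v) ` ann n R \<subseteq> ann n R" using w ann_add by blast
  ultimately have "bij_betw (\<lambda>v. w \<oplus> v) (ann n R) (ann n R)"
    using endo_inj_surj ann_finite unfolding bij_betw_def by blast
  from sum.reindex_bij_betw[OF this, of "\<lambda>v. f (x \<oplus> v)"]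
  show "avg n R f (x \<oplus> w) = avg n R f x" by (simp add: avg_def vadd_assoc)
qed

lemma avg_bounds:
  assumes "\<And>x. x \<in> V n \<Longrightarrow> 0 \<le> f x \<and> f x \<le> 1" "x \<in> V n"
  shows "0 \<le> avg n R f x \<and> avg n R f x \<le> 1"
proof -
  have "(\<Sum>w\<in>ann n R. f (x \<oplus> w)) \<le> (\<Sum>w\<in>ann n R. 1)"
    using assms by (intro sum_mono) (simp add: ann_V)
  moreover have "0 \<le> (\<Sum>w\<in>ann n R. f (x \<oplus> w))"
    using assms by (intro sum_nonneg) (simp add: ann_V)
  ultimately show ?thesis using ann_card_pos[of n R] by (simp add: avg_def)
qed

text \<open>\<open>avg\<close> is the orthogonal projection onto functions constant on cosets: g
  does not see the shift by w, so the shift can be undone on both factors together. Preservation of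
  the mean, the energy identity and the final error formula all rest on this.\<close>

lemma avg_adjoint:
  assumes "invariant n R g"
  shows "(\<Sum>x\<in>V n. avg n R f x * g x) = (\<Sum>x\<in>V n. f x * g x)"
proof -
  have "(\<Sum>x\<in>V n. avg n R f x * g x) = (\<Sum>x\<in>V n. \<Sum>w\<in>ann n R. f (x \<oplus> w) * g (x \<oplus> w)) / card (ann n R)"
    unfolding avg_def sum_divide_distrib
    using assms by (intro sum.cong refl) (simp add: invariant_def sum_distrib_right)
  also have "(\<Sum>x\<in>V n. \<Sum>w\<in>ann n R. f (x \<oplus> w) * g (x \<oplus> w)) = (\<Sum>w\<in>ann n R. \<Sum>x\<in>V n. f (x \<oplus> w) * g (x \<oplus> w))"
    by (rule sum.swap)
  also have "\<dots> = (\<Sum>w\<in>ann n R. \<Sum>x\<in>V n. f x * g x)"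
    using ann_V by (intro sum.cong refl sum_shift[where f = "\<lambda>x. f x * g x"]) auto
  finally show ?thesis using ann_card_pos[of n R] by simp
qed

lemma avg_sum: "(\<Sum>x\<in>V n. avg n R f x) = (\<Sum>x\<in>V n. f x)"
  using avg_adjoint[of n R "\<lambda>_. 1" f] by (simp add: invariant_def)

text \<open>Averaging is convolution with the uniform measure on the annihilator, so it acts on each
  coefficient by a multiplier.\<close>

lemma Fou_avg:
  "Fou n (avg n R f) r = Fou n f r * cnj (\<Sum>w\<in>ann n R. chr n r w) / of_nat (card (ann n R))"
proof -
  have "Fou n (avg n R f) r = (\<Sum>x\<in>V n. \<Sum>w\<in>ann n R. of_real (f (x \<oplus> w)) * chr n r x) / of_nat (card (ann n R))"
    unfolding Fou_def avg_def by (simp add: sum_divide_distrib sum_distrib_right)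
  also have "(\<Sum>x\<in>V n. \<Sum>w\<in>ann n R. of_real (f (x \<oplus> w)) * chr n r x)
    = (\<Sum>x\<in>V n. \<Sum>w\<in>ann n R. of_real (f (x \<oplus> w)) * chr n r (x \<oplus> w) * cnj (chr n r w))"
    by (simp add: chr_add mult.assoc chr_cnj)
  also have "\<dots> = (\<Sum>w\<in>ann n R. \<Sum>x\<in>V n. of_real (f (x \<oplus> w)) * chr n r (x \<oplus> w) * cnj (chr n r w))"
    by (rule sum.swap)
  also have "\<dots> = (\<Sum>w\<in>ann n R. Fou n f r * cnj (chr n r w))"
    unfolding Fou_def sum_distrib_right[symmetric]
    using ann_V by (intro sum.cong refl arg_cong2[of _ _ _ _ "(*)"] sum_shift[where f = "\<lambda>x. of_real (f x) * chr n r x"]) auto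
  finally show ?thesis by (simp add: sum_distrib_left)
qed

text \<open>On R the multiplier is 1 and the coefficient of the difference vanishes. Off R the
  coefficient of f is at most K, and the multiplier has norm at most 1, whence the factor 2.\<close>

lemma Fou_diff_avg:
  assumes R: "{r \<in> V n. norm (Fou n f r) > K} \<subseteq> R" and "0 \<le> K" "r \<in> V n"
  shows "norm (Fou n (\<lambda>x. f x - avg n R f x) r) \<le> 2 * K"
proof -
  let ?s = "cnj (\<Sum>w\<in>ann n R. chr n r w) / of_nat (card (ann n R))"
  have eq: "Fou n (\<lambda>x. f x - avg n R f x) r = Fou n f r * (1 - ?s)"
  proof -
    have "Fou n (\<lambda>x. f x - avg n R f x) r = Fou n f r - Fou n (avg n R f) r"
      by (simp add: Fou_def sum_subtractf[symmetric] algebra_simps)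
    then show ?thesis unfolding Fou_avg by (simp add: algebra_simps)
  qed
  show ?thesis
  proof (cases "r \<in> R")
    case True
    then have "(\<Sum>w\<in>ann n R. chr n r w) = of_nat (card (ann n R))"
      by (simp add: ann_def)
    then show ?thesis using eq ann_card_pos[of n R] \<open>0 \<le> K\<close> by simp
  next
    case False
    then have "norm (Fou n f r) \<le> K" using R \<open>r \<in> V n\<close> by force
    moreover have "norm (\<Sum>w\<in>ann n R. chr n r w) \<le> real (card (ann n R))"
      using sum_norm_le[of "ann n R" "chr n r" "\<lambda>_. 1"] by simp
    then have "norm ?s \<le> 1" using ann_card_pos[of n R] by (simp add: norm_divide del: cnj_sum)
    then have "norm (1 - ?s) \<le> 2" using norm_triangle_ineq4[of 1 ?s] by simp
    ultimately have "norm (Fou n f r) * norm (1 - ?s) \<le> K * 2" using \<open>0 \<le> K\<close> by (intro mult_mono) auto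
    then show ?thesis unfolding eq norm_mult by simp
  qed
qed

text \<open>Chebyshev's inequality applied to Parseval. The bound is free of n, and this keeps the
  codimension bounded.\<close>

lemma large_spectrum_card:
  assumes "\<And>x. x \<in> V n \<Longrightarrow> \<bar>f x\<bar> \<le> 1" "0 < \<delta>"
  shows "real (card {r \<in> V n. norm (Fou n f r) > \<delta> * real p ^ n}) \<le> 1 / \<delta>\<^sup>2"
proof -
  let ?S = "{r \<in> V n. norm (Fou n f r) > \<delta> * real p ^ n}"
  have "real (card ?S) * (\<delta> * real p ^ n)\<^sup>2 = (\<Sum>r\<in>?S. (\<delta> * real p ^ n)\<^sup>2)" by simp
  also have "\<dots> \<le> (\<Sum>r\<in>?S. (norm (Fou n f r))\<^sup>2)"
    using assms(2) by (intro sum_mono power_mono) auto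
  also have "\<dots> \<le> (\<Sum>r\<in>V n. (norm (Fou n f r))\<^sup>2)"
    by (intro sum_mono2) auto
  also have "\<dots> \<le> real p ^ n * real p ^ n" by (rule Fou_sum_le[OF assms(1)])
  finally have "(real (card ?S) * \<delta>\<^sup>2) * (real p ^ n * real p ^ n) \<le> 1 * (real p ^ n * real p ^ n)"
    by (simp add: power2_eq_square mult_ac)
  then have "real (card ?S) * \<delta>\<^sup>2 \<le> 1"
    by (rule mult_right_le_imp_le) (use p_pos in simp)
  then show ?thesis using assms(2) by (simp add: field_simps)
qed

text \<open>R is \<open>R0\<close> together with the large spectrum. The 6 is 3 slots times the
  factor 2 lost in the Fourier bound.\<close>

lemma obtain_uniform_avg:
  assumes f: "\<And>x. x \<in> V n \<Longrightarrow> 0 \<le> f x \<and> f x \<le> 1" and "0 < \<delta>" "R0 \<subseteq> V n"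
  obtains R where "R0 \<subseteq> R" "R \<subseteq> V n" "real (card R) \<le> real (card R0) + 1 / \<delta>\<^sup>2"
    "\<bar>T n f f f - T n (avg n R f) (avg n R f) (avg n R f)\<bar> \<le> 6 * \<delta> * real p ^ n * real p ^ n"
proof
  let ?S = "{r \<in> V n. norm (Fou n f r) > \<delta> * real p ^ n}"
  let ?R = "R0 \<union> ?S"
  show "R0 \<subseteq> ?R" "?R \<subseteq> V n" using assms(3) by auto
  have "\<bar>f x\<bar> \<le> 1" if "x \<in> V n" for x using f[OF that] by simp
  then have "real (card ?S) \<le> 1 / \<delta>\<^sup>2" using assms(2) by (rule large_spectrum_card)
  moreover have "real (card ?R) \<le> real (card R0) + real (card ?S)"
    using card_Un_le[of R0 ?S] by linarith
  ultimately show "real (card ?R) \<le> real (card R0) + 1 / \<delta>\<^sup>2" by linarith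
  have "\<bar>T n f f f - T n (avg n ?R f) (avg n ?R f) (avg n ?R f)\<bar> \<le> 3 * (2 * (\<delta> * real p ^ n)) * real p ^ n"
    using f assms(2) by (intro T_stable avg_bounds Fou_diff_avg) auto
  then show "\<bar>T n f f f - T n (avg n ?R f) (avg n ?R f) (avg n ?R f)\<bar> \<le> 6 * \<delta> * real p ^ n * real p ^ n"
    by (simp add: mult_ac)
qed

subsection \<open>Counting progressions in dense functions\<close>

text \<open>Pythagoras: the coarse average is the orthogonal projection of the fine one.\<close>

lemma energy_diff:
  assumes "R \<subseteq> R'"
  shows "(\<Sum>x\<in>V n. (avg n R' f x - avg n R f x)\<^sup>2) = (\<Sum>x\<in>V n. (avg n R' f x)\<^sup>2) - (\<Sum>x\<in>V n. (avg n R f x)\<^sup>2)"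
proof -
  have "(\<Sum>x\<in>V n. avg n R' f x * avg n R f x) = (\<Sum>x\<in>V n. f x * avg n R f x)"
    using assms by (intro avg_adjoint invariant_mono[OF avg_invariant])
  also have "\<dots> = (\<Sum>x\<in>V n. avg n R f x * avg n R f x)"
    by (intro avg_adjoint[symmetric] avg_invariant)
  finally have "(\<Sum>x\<in>V n. avg n R' f x * avg n R f x) = (\<Sum>x\<in>V n. (avg n R f x)\<^sup>2)"
    by (simp add: power2_eq_square)
  moreover have "(\<Sum>x\<in>V n. (avg n R' f x - avg n R f x)\<^sup>2) =
    (\<Sum>x\<in>V n. (avg n R' f x)\<^sup>2) + (\<Sum>x\<in>V n. (avg n R f x)\<^sup>2) - 2 * (\<Sum>x\<in>V n. avg n R' f x * avg n R f x)"
    by (simp add: power2_diff sum.distrib sum_subtractf sum_distrib_left mult.assoc)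
  ultimately show ?thesis by simp
qed

text \<open>For a difference d in the annihilator, h is equal at all three terms, which yields the
  sum of cubes; replacing h by g costs its L1 distance once per term.\<close>

lemma T_lower_of_close:
  assumes g: "\<And>x. x \<in> V n \<Longrightarrow> 0 \<le> g x \<and> g x \<le> 1" and h: "\<And>x. x \<in> V n \<Longrightarrow> 0 \<le> h x \<and> h x \<le> 1"
    and inv: "invariant n R h"
  shows "real (card (ann n R)) * ((\<Sum>x\<in>V n. h x ^ 3) - 3 * (\<Sum>x\<in>V n. \<bar>g x - h x\<bar>)) \<le> T n g g g"
proof -
  let ?\<Delta> = "\<lambda>x. \<bar>g x - h x\<bar>"
  have "real (card (ann n R)) * ((\<Sum>x\<in>V n. h x ^ 3) - 3 * (\<Sum>x\<in>V n. ?\<Delta> x))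
    = (\<Sum>d\<in>ann n R. \<Sum>m\<in>V n. h m * h (m \<oplus> d) * h (m \<oplus> (d \<oplus> d)) - (?\<Delta> m + ?\<Delta> (m \<oplus> d) + ?\<Delta> (m \<oplus> (d \<oplus> d))))"
  proof -
    have "(\<Sum>m\<in>V n. h m * h (m \<oplus> d) * h (m \<oplus> (d \<oplus> d)) - (?\<Delta> m + ?\<Delta> (m \<oplus> d) + ?\<Delta> (m \<oplus> (d \<oplus> d))))
      = (\<Sum>x\<in>V n. h x ^ 3) - 3 * (\<Sum>x\<in>V n. ?\<Delta> x)" if d: "d \<in> ann n R" for d
    proof -
      have "(\<Sum>m\<in>V n. h m * h (m \<oplus> d) * h (m \<oplus> (d \<oplus> d))) = (\<Sum>x\<in>V n. h x ^ 3)"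
        using inv d ann_add[OF d d] by (intro sum.cong refl) (simp add: invariant_def power3_eq_cube)
      moreover have "(\<Sum>m\<in>V n. ?\<Delta> (m \<oplus> d)) = (\<Sum>m\<in>V n. ?\<Delta> m)"
        "(\<Sum>m\<in>V n. ?\<Delta> (m \<oplus> (d \<oplus> d))) = (\<Sum>m\<in>V n. ?\<Delta> m)"
        using ann_V[OF d] by (auto intro!: sum_shift[where f = ?\<Delta>])
      ultimately show ?thesis by (simp add: sum_subtractf sum.distrib)
    qed
    then show ?thesis by simp
  qed
  also have "\<dots> \<le> (\<Sum>d\<in>ann n R. \<Sum>m\<in>V n. g m * g (m \<oplus> d) * g (m \<oplus> (d \<oplus> d)))"
    using g h ann_V by (intro sum_mono prod_diff_bound) auto
  \<comment> \<open>The remaining differences contribute nonnegative terms.\<close>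
  also have "\<dots> \<le> (\<Sum>d\<in>V n. \<Sum>m\<in>V n. g m * g (m \<oplus> d) * g (m \<oplus> (d \<oplus> d)))"
    using g ann_V by (intro sum_mono2 sum_nonneg mult_nonneg_nonneg) auto
  also have "\<dots> = T n g g g" unfolding T_def by (rule sum.swap)
  finally show ?thesis .
qed

text \<open>Convexity, through the tangent to y^3 at \<eta>.\<close>

lemma sum_cubes_ge:
  assumes "\<And>x. x \<in> V n \<Longrightarrow> 0 \<le> g x" "0 \<le> \<eta>" "\<eta> * real p ^ n \<le> (\<Sum>x\<in>V n. g x)"
  shows "\<eta> ^ 3 * real p ^ n \<le> (\<Sum>x\<in>V n. g x ^ 3)"
proof -
  have "3 * \<eta>\<^sup>2 * y - 2 * \<eta> ^ 3 \<le> y ^ 3" if "0 \<le> y" for y :: real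
  proof -
    have "0 \<le> (y - \<eta>)\<^sup>2 * (y + 2 * \<eta>)" using that assms(2) by simp
    then show ?thesis by (simp add: algebra_simps power2_eq_square power3_eq_cube)
  qed
  then have "(\<Sum>x\<in>V n. 3 * \<eta>\<^sup>2 * g x - 2 * \<eta> ^ 3) \<le> (\<Sum>x\<in>V n. g x ^ 3)"
    using assms(1) by (intro sum_mono) auto
  moreover have "(\<Sum>x\<in>V n. 3 * \<eta>\<^sup>2 * g x - 2 * \<eta> ^ 3) = 3 * \<eta>\<^sup>2 * (\<Sum>x\<in>V n. g x) - 2 * \<eta> ^ 3 * real p ^ n"
    by (simp add: sum_subtractf sum_distrib_left card_V)
  moreover have "3 * \<eta>\<^sup>2 * (\<eta> * real p ^ n) \<le> 3 * \<eta>\<^sup>2 * (\<Sum>x\<in>V n. g x)"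
    using assms(3) by (intro mult_left_mono) auto
  ultimately show ?thesis by (simp add: power2_eq_square power3_eq_cube mult.assoc)
qed

lemma ann_density:
  assumes "finite R" "card R \<le> k"
  shows "real p ^ n / real p ^ k \<le> real (card (ann n R))"
proof -
  have "p ^ card R \<le> p ^ k" using assms(2) p_pos by (simp add: power_increasing)
  then have "p ^ n \<le> p ^ k * card (ann n R)"
    using ann_card[OF assms(1), of n] by (meson le_trans mult_le_mono1)
  then have "real p ^ n \<le> real p ^ k * real (card (ann n R))"
    by (metis of_nat_le_iff of_nat_mult of_nat_power)
  then show ?thesis using p_pos by (simp add: field_simps)
qed

text \<open>Refine the averaging subspace by the large spectrum at a level far below its density. If this
  leaves the energy almost unchanged, the new average is close to a function with many
  progressions whose difference lies in the old subspace.\<close>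

lemma energy_increment:
  fixes k :: nat
  assumes "0 < \<eta>"
  defines "\<kappa> \<equiv> (\<eta> ^ 3 / 6)\<^sup>2"
  shows "\<exists>\<tau>>0. \<exists>k'. \<forall>n f R. (\<forall>x\<in>V n. 0 \<le> f x \<and> f x \<le> 1) \<longrightarrow> \<eta> * real p ^ n \<le> (\<Sum>x\<in>V n. f x) \<longrightarrow>
    R \<subseteq> V n \<longrightarrow> card R \<le> k \<longrightarrow> \<tau> * real p ^ n * real p ^ n \<le> T n f f f \<or>
    (\<exists>R'\<subseteq>V n. card R' \<le> k' \<and>
      (\<Sum>x\<in>V n. (avg n R f x)\<^sup>2) + \<kappa> * real p ^ n \<le> (\<Sum>x\<in>V n. (avg n R' f x)\<^sup>2))"
proof -
  \<comment> \<open>The old subspace has density at least p^-k, and \<eta>^3 - 3t = \<eta>^3/2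
    remains of the cubes, so the new average has proportion at least 2\<tau>. With \<delta> =
    \<tau>/6, returning to f loses 6\<delta> = \<tau>.\<close>
  define \<tau> where "\<tau> = \<eta> ^ 3 / (4 * real p ^ k)"
  define \<delta> where "\<delta> = \<tau> / 6"
  define k' where "k' = k + nat \<lceil>1 / \<delta>\<^sup>2\<rceil>"
  define t where "t = \<eta> ^ 3 / 6"
  have pos: "0 < \<tau>" "0 < \<delta>" "0 < t" using assms p_pos by (simp_all add: \<tau>_def \<delta>_def t_def)
  show ?thesis
  proof (intro exI[of _ \<tau>] exI[of _ k'] conjI allI impI)
    fix n f R
    assume f: "\<forall>x\<in>V n. 0 \<le> f x \<and> f x \<le> 1" and dense: "\<eta> * real p ^ n \<le> (\<Sum>x\<in>V n. f x)"
      and R: "R \<subseteq> V n" "card R \<le> k"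
    obtain R' where R': "R \<subseteq> R'" "R' \<subseteq> V n" "real (card R') \<le> real (card R) + 1 / \<delta>\<^sup>2"
      and Tdiff: "\<bar>T n f f f - T n (avg n R' f) (avg n R' f) (avg n R' f)\<bar> \<le> 6 * \<delta> * real p ^ n * real p ^ n"
      using obtain_uniform_avg[of n f \<delta> R] f pos(2) R(1) by metis
    define g where "g = avg n R' f"
    define h where "h = avg n R f"
    have g: "0 \<le> g x \<and> g x \<le> 1" and h: "0 \<le> h x \<and> h x \<le> 1" if "x \<in> V n" for x
      using avg_bounds f that by (auto simp: g_def h_def)
    have "card R' \<le> k'" using R' R(2) unfolding k'_def by linarith
    show "\<tau> * real p ^ n * real p ^ n \<le> T n f f f \<or>
      (\<exists>R'\<subseteq>V n. card R' \<le> k' \<and>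
        (\<Sum>x\<in>V n. (avg n R f x)\<^sup>2) + \<kappa> * real p ^ n \<le> (\<Sum>x\<in>V n. (avg n R' f x)\<^sup>2))"
    proof (cases "(\<Sum>x\<in>V n. (h x)\<^sup>2) + \<kappa> * real p ^ n \<le> (\<Sum>x\<in>V n. (g x)\<^sup>2)")
      case True
      then show ?thesis using R' \<open>card R' \<le> k'\<close> by (auto simp: g_def h_def)
    next
      case False
      then have small: "(\<Sum>x\<in>V n. (g x - h x)\<^sup>2) \<le> t\<^sup>2 * real p ^ n"
        using energy_diff[OF R'(1), of n f] by (simp add: g_def h_def \<kappa>_def t_def)
      \<comment> \<open>Passes from L2 to L1: a mean square of at most \<kappa> = t^2 gives a mean
        absolute value of at most t.\<close>
      have "\<bar>y\<bar> \<le> y\<^sup>2 / (2 * t) + t / 2" for y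
      proof -
        have "0 \<le> (\<bar>y\<bar> - t)\<^sup>2" by simp
        then have "2 * t * \<bar>y\<bar> \<le> y\<^sup>2 + t\<^sup>2" by (simp add: power2_diff mult_ac)
        then show ?thesis using pos(3) by (simp add: field_simps power2_eq_square)
      qed
      then have "(\<Sum>x\<in>V n. \<bar>g x - h x\<bar>) \<le> (\<Sum>x\<in>V n. (g x - h x)\<^sup>2 / (2 * t) + t / 2)"
        by (intro sum_mono)
      also have "\<dots> = (\<Sum>x\<in>V n. (g x - h x)\<^sup>2) / (2 * t) + t / 2 * real p ^ n"
        by (simp add: sum.distrib sum_divide_distrib card_V)
      also have "\<dots> \<le> (t\<^sup>2 * real p ^ n) / (2 * t) + t / 2 * real p ^ n"
        using small pos(3) by (intro add_right_mono divide_right_mono) auto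
      also have "\<dots> = t * real p ^ n" using pos(3) by (simp add: power2_eq_square field_simps)
      finally have close: "(\<Sum>x\<in>V n. \<bar>g x - h x\<bar>) \<le> t * real p ^ n" .
      have cubes: "\<eta> ^ 3 * real p ^ n \<le> (\<Sum>x\<in>V n. h x ^ 3)"
        using h assms(1) dense by (intro sum_cubes_ge) (auto simp: h_def avg_sum)
      have "finite R" using R(1) finite_subset finite_V by blast
      have "2 * \<tau> * real p ^ n * real p ^ n = (real p ^ n / real p ^ k) * (\<eta> ^ 3 / 2 * real p ^ n)"
          by (simp add: \<tau>_def mult_ac)
      also have "\<dots> \<le> real (card (ann n R)) * ((\<Sum>x\<in>V n. h x ^ 3) - 3 * (\<Sum>x\<in>V n. \<bar>g x - h x\<bar>))"
        using ann_density[OF \<open>finite R\<close> R(2)] cubes close assms(1)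
        by (intro mult_mono) (simp_all add: t_def)
      also have "\<dots> \<le> T n g g g"
        using T_lower_of_close[of n g h R] g h avg_invariant[of n R f] unfolding h_def by blast
      finally have "2 * (\<tau> * real p ^ n * real p ^ n) \<le> T n g g g" by (simp only: mult.assoc)
      moreover have "\<bar>T n f f f - T n g g g\<bar> \<le> \<tau> * real p ^ n * real p ^ n"
        using Tdiff by (simp add: g_def \<delta>_def)
      ultimately have "\<tau> * real p ^ n * real p ^ n \<le> T n f f f" by linarith
      then show ?thesis ..
    qed
  qed (rule pos(1))
qed

text \<open>The energy is at most p^n and every failed attempt raises it by \<kappa> p^n, so a
  number of refinements depending on \<eta> alone suffices. Hence \<tau> does not depend on
  n.\<close>

lemma progressions_dense:
  assumes "0 < \<eta>"
  shows "\<exists>\<tau>>0. \<forall>n f. (\<forall>x\<in>V n. 0 \<le> f x \<and> f x \<le> 1) \<longrightarrow> \<eta> * real p ^ n \<le> (\<Sum>x\<in>V n. f x) \<longrightarrow>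
    \<tau> * real p ^ n * real p ^ n \<le> T n f f f"
proof -
  define \<kappa> where "\<kappa> = (\<eta> ^ 3 / 6)\<^sup>2"
  have "0 < \<kappa>" using assms by (simp add: \<kappa>_def)
  \<comment> \<open>M bounds the increments that still fit below the maximal energy. The bound k on
    the frequencies grows at each refinement, so the induction keeps it arbitrary.\<close>
  have *: "\<exists>\<tau>>0. \<forall>n f R. (\<forall>x\<in>V n. 0 \<le> f x \<and> f x \<le> 1) \<longrightarrow> \<eta> * real p ^ n \<le> (\<Sum>x\<in>V n. f x) \<longrightarrow>
    R \<subseteq> V n \<longrightarrow> card R \<le> k \<longrightarrow> (1 - real M * \<kappa>) * real p ^ n \<le> (\<Sum>x\<in>V n. (avg n R f x)\<^sup>2) \<longrightarrow>
    \<tau> * real p ^ n * real p ^ n \<le> T n f f f" for k M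
  proof (induction M arbitrary: k)
    case 0
    obtain \<tau> k' where "\<tau> > 0" and step: "\<And>n f R. (\<forall>x\<in>V n. 0 \<le> f x \<and> f x \<le> 1) \<Longrightarrow>
        \<eta> * real p ^ n \<le> (\<Sum>x\<in>V n. f x) \<Longrightarrow> R \<subseteq> V n \<Longrightarrow> card R \<le> k \<Longrightarrow>
        \<tau> * real p ^ n * real p ^ n \<le> T n f f f \<or> (\<exists>R'\<subseteq>V n. card R' \<le> k' \<and>
        (\<Sum>x\<in>V n. (avg n R f x)\<^sup>2) + \<kappa> * real p ^ n \<le> (\<Sum>x\<in>V n. (avg n R' f x)\<^sup>2))"
      using energy_increment[OF assms, of k] unfolding \<kappa>_def by metis
    have "\<tau> * real p ^ n * real p ^ n \<le> T n f f f"
      if f: "\<forall>x\<in>V n. 0 \<le> f x \<and> f x \<le> 1" and dense: "\<eta> * real p ^ n \<le> (\<Sum>x\<in>V n. f x)"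
        and R: "R \<subseteq> V n" "card R \<le> k" and e: "real p ^ n \<le> (\<Sum>x\<in>V n. (avg n R f x)\<^sup>2)" for n f R
    proof (rule disjE[OF step[OF f dense R]])
      \<comment> \<open>The energy is already maximal, so no increment is possible.\<close>
      assume "\<exists>R'\<subseteq>V n. card R' \<le> k' \<and>
        (\<Sum>x\<in>V n. (avg n R f x)\<^sup>2) + \<kappa> * real p ^ n \<le> (\<Sum>x\<in>V n. (avg n R' f x)\<^sup>2)"
      then obtain R' where "(\<Sum>x\<in>V n. (avg n R f x)\<^sup>2) + \<kappa> * real p ^ n \<le> (\<Sum>x\<in>V n. (avg n R' f x)\<^sup>2)"
        by blast
      moreover have "(\<Sum>x\<in>V n. (avg n R' f x)\<^sup>2) \<le> (\<Sum>x\<in>V n. 1)"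
        using avg_bounds f by (intro sum_mono) (simp add: abs_square_le_1 abs_le_iff)
      moreover have "0 < \<kappa> * real p ^ n" using \<open>0 < \<kappa>\<close> p_pos by simp
      ultimately show ?thesis using e by (simp add: card_V)
    qed
    then show ?case using \<open>\<tau> > 0\<close> by (intro exI[of _ \<tau>]) auto
  next
    case (Suc M)
    obtain \<tau> k' where "\<tau> > 0" and step: "\<And>n f R. (\<forall>x\<in>V n. 0 \<le> f x \<and> f x \<le> 1) \<Longrightarrow>
        \<eta> * real p ^ n \<le> (\<Sum>x\<in>V n. f x) \<Longrightarrow> R \<subseteq> V n \<Longrightarrow> card R \<le> k \<Longrightarrow>
        \<tau> * real p ^ n * real p ^ n \<le> T n f f f \<or> (\<exists>R'\<subseteq>V n. card R' \<le> k' \<and>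
        (\<Sum>x\<in>V n. (avg n R f x)\<^sup>2) + \<kappa> * real p ^ n \<le> (\<Sum>x\<in>V n. (avg n R' f x)\<^sup>2))"
      using energy_increment[OF assms, of k] unfolding \<kappa>_def by metis
    obtain \<tau>' where "\<tau>' > 0" and IH: "\<And>n f R. (\<forall>x\<in>V n. 0 \<le> f x \<and> f x \<le> 1) \<Longrightarrow>
        \<eta> * real p ^ n \<le> (\<Sum>x\<in>V n. f x) \<Longrightarrow> R \<subseteq> V n \<Longrightarrow> card R \<le> k' \<Longrightarrow>
        (1 - real M * \<kappa>) * real p ^ n \<le> (\<Sum>x\<in>V n. (avg n R f x)\<^sup>2) \<Longrightarrow>
        \<tau>' * real p ^ n * real p ^ n \<le> T n f f f"
      using Suc.IH[of k'] by metis
    have "min \<tau> \<tau>' * real p ^ n * real p ^ n \<le> T n f f f"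
      if f: "\<forall>x\<in>V n. 0 \<le> f x \<and> f x \<le> 1" and dense: "\<eta> * real p ^ n \<le> (\<Sum>x\<in>V n. f x)"
        and R: "R \<subseteq> V n" "card R \<le> k"
        and e: "(1 - real (Suc M) * \<kappa>) * real p ^ n \<le> (\<Sum>x\<in>V n. (avg n R f x)\<^sup>2)" for n f R
    proof -
      have "\<tau> * real p ^ n * real p ^ n \<le> T n f f f \<or> \<tau>' * real p ^ n * real p ^ n \<le> T n f f f"
        using step[OF f dense R]
      proof
        assume "\<exists>R'\<subseteq>V n. card R' \<le> k' \<and>
          (\<Sum>x\<in>V n. (avg n R f x)\<^sup>2) + \<kappa> * real p ^ n \<le> (\<Sum>x\<in>V n. (avg n R' f x)\<^sup>2)"
        then obtain R' where R': "R' \<subseteq> V n" "card R' \<le> k'"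
          and "(\<Sum>x\<in>V n. (avg n R f x)\<^sup>2) + \<kappa> * real p ^ n \<le> (\<Sum>x\<in>V n. (avg n R' f x)\<^sup>2)"
          by blast
        then have "(1 - real M * \<kappa>) * real p ^ n \<le> (\<Sum>x\<in>V n. (avg n R' f x)\<^sup>2)"
          using e by (simp add: algebra_simps)
        then show ?thesis using IH[OF f dense R'] by blast
      qed blast
      moreover have "min \<tau> \<tau>' * real p ^ n * real p ^ n \<le> \<tau> * real p ^ n * real p ^ n"
        "min \<tau> \<tau>' * real p ^ n * real p ^ n \<le> \<tau>' * real p ^ n * real p ^ n"
        by (intro mult_right_mono; simp)+
      ultimately show ?thesis by linarith
    qed
    then show ?case using \<open>\<tau> > 0\<close> \<open>\<tau>' > 0\<close> by (intro exI[of _ "min \<tau> \<tau>'"]) auto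
  qed
  \<comment> \<open>For such M the energy hypothesis holds trivially, and the iteration starts from
    the empty set of frequencies.\<close>
  obtain M :: nat where "1 \<le> real M * \<kappa>"
    using reals_Archimedean3[OF \<open>0 < \<kappa>\<close>] by (meson less_imp_le)
  have e: "(1 - real M * \<kappa>) * real p ^ n \<le> (\<Sum>x\<in>V n. (avg n {} f x)\<^sup>2)" for n f
    using \<open>1 \<le> real M * \<kappa>\<close>
    by (intro order_trans[OF mult_nonpos_nonneg sum_nonneg]) auto
  obtain \<tau> where "\<tau> > 0" "\<forall>n f R. (\<forall>x\<in>V n. 0 \<le> f x \<and> f x \<le> 1) \<longrightarrow> \<eta> * real p ^ n \<le> (\<Sum>x\<in>V n. f x) \<longrightarrow>
    R \<subseteq> V n \<longrightarrow> card R \<le> 0 \<longrightarrow> (1 - real M * \<kappa>) * real p ^ n \<le> (\<Sum>x\<in>V n. (avg n R f x)\<^sup>2) \<longrightarrow>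
    \<tau> * real p ^ n * real p ^ n \<le> T n f f f"
    using *[of 0 M] by blast
  then show ?thesis using e by (intro exI[of _ \<tau>]) (metis card.empty empty_subsetI order_refl)
qed

subsection \<open>A perturbation with fewer progressions\<close>

text \<open>A mean-zero function on F_p that takes mass away from the point 0. The sign matters: its
  triple correlation along progressions is negative, that of its negative is positive.\<close>

definition bump :: "nat \<Rightarrow> real" where "bump a = 1 / real p - of_bool (a = 0)"

lemma sum_affine_reindex:
  assumes "0 < b" "b < p"
  shows "(\<Sum>s<p. H ((a + s * b) mod p)) = (\<Sum>y<p. H y)"
proof -
  have "coprime b p"
    using assms prime by (metis coprime_commute nat_dvd_not_less prime_imp_coprime)
  have "inj_on (\<lambda>s. (a + s * b) mod p) {..<p}"
  proof (rule inj_onI)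
    fix s t assume st: "s \<in> {..<p}" "t \<in> {..<p}" and "(a + s * b) mod p = (a + t * b) mod p"
    then have "[s * b = t * b] (mod p)"
      by (metis cong_add_lcancel_nat unique_euclidean_semiring_class.cong_def)
    then have "[s = t] (mod p)" using \<open>coprime b p\<close> by (metis cong_mult_rcancel_nat)
    then show "s = t" using st by (simp add: cong_less_modulus_unique_nat)
  qed
  moreover have "(\<lambda>s. (a + s * b) mod p) ` {..<p} \<subseteq> {..<p}" using p_pos by auto
  ultimately have "bij_betw (\<lambda>s. (a + s * b) mod p) {..<p} {..<p}"
    using endo_inj_surj finite_lessThan unfolding bij_betw_def by blast
  then show ?thesis by (rule sum.reindex_bij_betw)
qed

lemma sum_translate: "(\<Sum>s<p. H ((a + s) mod p)) = (\<Sum>y<p. H y)"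
  using sum_affine_reindex[of 1 H a] p_gt_2 by simp

lemma sum_bump: "(\<Sum>y<p. bump y) = 0"
  using p_pos by (simp add: bump_def sum_subtractf of_bool_def)

text \<open>Any two terms of y, y + z, y + 2z determine the third and range independently over F_p,
  so the mean-zero \<open>bump\<close> kills all terms with one or two factors u. The triple term
  comes from the constant progression at 0.\<close>

lemma sum_bump_product:
  "(\<Sum>y<p. \<Sum>z<p. (g1 + u1 * bump y) * (g2 + u2 * bump ((y + z) mod p)) *
      (g3 + u3 * bump ((y + (z + z) mod p) mod p)))
    = (real p)\<^sup>2 * (g1 * g2 * g3) - (1 - 1 / real p) * (u1 * u2 * u3)"
proof -
  let ?A = "\<lambda>y z. of_bool (y = 0) :: real"
  let ?B = "\<lambda>y z. of_bool ((y + z) mod p = 0) :: real"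
  let ?C = "\<lambda>y z. of_bool ((y + (z + z) mod p) mod p = 0) :: real"
  let ?E = "\<lambda>y z. of_bool (y = 0 \<and> z = (0::nat)) :: real"
  \<comment> \<open>Absorbing 1/p into the constants turns each factor into a constant minus a
    multiple of an indicator.\<close>
  define G1 G2 G3 where "G1 = g1 + u1 / real p" and "G2 = g2 + u2 / real p" and "G3 = g3 + u3 / real p"
  have eq: "(g1 + u1 * bump y) * (g2 + u2 * bump ((y + z) mod p)) * (g3 + u3 * bump ((y + (z + z) mod p) mod p))
    = G1 * G2 * G3 - u1 * G2 * G3 * ?A y z - u2 * G1 * G3 * ?B y z - u3 * G1 * G2 * ?C y z
      + (u1 * u2 * G3 + u1 * u3 * G2 + u2 * u3 * G1 - u1 * u2 * u3) * ?E y z" if "y < p" "z < p" for y z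
  proof -
    \<comment> \<open>Two zeros among the three terms force y = z = 0. For the outer pair this says
      that 2z = 0 implies z = 0.\<close>
    have dvd: "p dvd m \<Longrightarrow> m < p \<Longrightarrow> m = 0" for m using nat_dvd_not_less by blast
    have p2: "p dvd 2 * m \<Longrightarrow> m < p \<Longrightarrow> m = 0" for m
      using prime_dvd_mult_iff[OF prime, of 2 m] p_gt_2 dvd_imp_le[of p 2] dvd by fastforce
    have ab: "?A y z * ?B y z = ?E y z" using that dvd[of z] by (auto simp: mod_eq_0_iff_dvd)
    have ac: "?A y z * ?C y z = ?E y z" using that p2[of z] by (auto simp: mod_simps mod_eq_0_iff_dvd mult_2)
    have bc: "?B y z * ?C y z = ?E y z"
    proof -
      have "z = 0" if "p dvd y + z" "p dvd y + (z + z)"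
        using that \<open>z < p\<close> dvd dvd_add_right_iff[of p "y + z" z] by (simp add: add.assoc)
      then show ?thesis using that dvd[of y] by (auto simp: mod_simps mod_eq_0_iff_dvd)
    qed
    have ec: "?E y z * ?C y z = ?E y z" by (auto simp: of_bool_def)
    have "(g1 + u1 * (1 / real p - a)) * (g2 + u2 * (1 / real p - b)) * (g3 + u3 * (1 / real p - c))
      = G1 * G2 * G3 - u1 * G2 * G3 * a - u2 * G1 * G3 * b - u3 * G1 * G2 * c
        + (u1 * u2 * G3 + u1 * u3 * G2 + u2 * u3 * G1 - u1 * u2 * u3) * e"
      if "a * b = e" "a * c = e" "b * c = e" "e * c = e" for a b c e
    proof -
      define r where "r = 1 / real p"
      have G: "G1 = g1 + u1 * r" "G2 = g2 + u2 * r" "G3 = g3 + u3 * r"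
        by (simp_all add: G1_def G2_def G3_def r_def)
      have "(g1 + u1 * (r - a)) * (g2 + u2 * (r - b)) * (g3 + u3 * (r - c))
        = G1 * G2 * G3 - u1 * G2 * G3 * a - u2 * G1 * G3 * b - u3 * G1 * G2 * c
          + u1 * u2 * G3 * (a * b) + u1 * u3 * G2 * (a * c) + u2 * u3 * G1 * (b * c) - u1 * u2 * u3 * (a * b * c)"
        unfolding G by algebra
      then show ?thesis unfolding that r_def by (simp add: algebra_simps)
    qed
    from this[OF ab ac bc ec] show ?thesis unfolding bump_def .
  qed
  have A: "(\<Sum>y<p. \<Sum>z<p. ?A y z) = real p"
    using p_pos by (simp add: sum_distrib_left[symmetric] of_bool_def if_distrib[of "\<lambda>x. _ * x"] cong: if_cong)
  have d: "(\<Sum>y<p. of_bool (y = 0)) = (1::real)" using p_pos by (simp add: of_bool_def)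
  have B: "(\<Sum>y<p. \<Sum>z<p. ?B y z) = real p"
    using sum_translate[of "\<lambda>m. of_bool (m = 0) :: real"] by (simp add: d)
  have "(\<Sum>y<p. \<Sum>z<p. ?C y z) = (\<Sum>z<p. \<Sum>y<p. of_bool (((z + z) mod p + y) mod p = 0))"
    by (subst sum.swap) (simp add: add.commute)
  also have "\<dots> = real p"
    using sum_translate[of "\<lambda>m. of_bool (m = 0) :: real"] by (simp add: d)
  finally have C: "(\<Sum>y<p. \<Sum>z<p. ?C y z) = real p" .
  have E: "(\<Sum>y<p. \<Sum>z<p. ?E y z) = 1"
    unfolding of_bool_conj sum_distrib_left[symmetric] d using d by simp
  have "(\<Sum>y<p. \<Sum>z<p. (g1 + u1 * bump y) * (g2 + u2 * bump ((y + z) mod p)) *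
      (g3 + u3 * bump ((y + (z + z) mod p) mod p)))
    = (\<Sum>y<p. \<Sum>z<p. G1 * G2 * G3 - u1 * G2 * G3 * ?A y z - u2 * G1 * G3 * ?B y z - u3 * G1 * G2 * ?C y z
      + (u1 * u2 * G3 + u1 * u3 * G2 + u2 * u3 * G1 - u1 * u2 * u3) * ?E y z)"
    by (intro sum.cong refl eq) auto
  also have "\<dots> = (real p)\<^sup>2 * (G1 * G2 * G3) - u1 * G2 * G3 * real p - u2 * G1 * G3 * real p - u3 * G1 * G2 * real p
      + (u1 * u2 * G3 + u1 * u3 * G2 + u2 * u3 * G1 - u1 * u2 * u3)"
    unfolding sum.distrib sum_subtractf sum_distrib_left[symmetric] A B C E by (simp add: power2_eq_square)
  also have "\<dots> = (real p)\<^sup>2 * (g1 * g2 * g3) - (1 - 1 / real p) * (u1 * u2 * u3)"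
    using p_pos unfolding G1_def G2_def G3_def by (simp add: field_simps power2_eq_square)
  finally show ?thesis .
qed

text \<open>Shift m by s w and d by t w and average over s and t. The functions g and u do not
  notice, while the i-th coordinates of m and d run through all pairs of residues because w i is a
  unit. The identity over F_p then applies to each progression separately.\<close>

lemma perturb:
  assumes w: "w \<in> ann n R" "w i \<noteq> 0" and g: "invariant n R g" and u: "invariant n R u"
  defines "F \<equiv> \<lambda>x. g x + u x * bump (x i)"
  shows "(\<Sum>x\<in>V n. F x) = (\<Sum>x\<in>V n. g x)"
    and "T n F F F = T n g g g - (1 - 1 / real p) / (real p)\<^sup>2 * T n u u u"
proof -
  let ?w = "\<lambda>s. smul s w"
  have wV: "?w s \<in> V n" for s using w ann_V by simp
  have wi: "0 < w i" "w i < p" using w VD[OF ann_V[OF w(1)]] by auto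
  have coord: "(x \<oplus> ?w s) i = (x i + s * w i) mod p" for x s
    by (simp add: vadd_def smul_def mod_simps)
  have gu: "g (x \<oplus> v) = g x" "u (x \<oplus> v) = u x" if "x \<in> V n" "v \<in> ann n R" for x v
    using g u that by (auto simp: invariant_def)
  have wR: "?w s \<in> ann n R" for s using w(1) by (rule ann_smul)
  have "real p * (\<Sum>x\<in>V n. F x) = (\<Sum>s<p. \<Sum>x\<in>V n. F x)" by simp
  also have "\<dots> = (\<Sum>s<p. \<Sum>x\<in>V n. F (x \<oplus> ?w s))"
    by (intro sum.cong refl sum_shift[OF wV, symmetric])
  also have "\<dots> = (\<Sum>x\<in>V n. \<Sum>s<p. F (x \<oplus> ?w s))" by (rule sum.swap)
  also have "\<dots> = (\<Sum>x\<in>V n. \<Sum>s<p. g x + u x * bump ((x i + s * w i) mod p))"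
    unfolding F_def coord by (simp add: gu wR)
  also have "\<dots> = (\<Sum>x\<in>V n. real p * g x)"
    by (simp add: sum.distrib sum_distrib_left[symmetric] sum_affine_reindex[OF wi, where H = bump] sum_bump)
  finally show "(\<Sum>x\<in>V n. F x) = (\<Sum>x\<in>V n. g x)"
    using p_pos by (simp add: sum_distrib_left[symmetric])
  let ?P = "\<lambda>F m d. F m * F (m \<oplus> d) * F (m \<oplus> (d \<oplus> d)) :: real"
  have shift: "T n F F F = (\<Sum>m\<in>V n. \<Sum>d\<in>V n. ?P F (m \<oplus> ?w s) (d \<oplus> ?w t))" for s t
  proof -
    have "T n F F F = (\<Sum>m\<in>V n. \<Sum>d\<in>V n. ?P F (m \<oplus> ?w s) d)"
      unfolding T_def by (rule sum_shift[OF wV, where f = "\<lambda>m. \<Sum>d\<in>V n. ?P F m d", symmetric])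
    also have "\<dots> = (\<Sum>m\<in>V n. \<Sum>d\<in>V n. ?P F (m \<oplus> ?w s) (d \<oplus> ?w t))"
      by (intro sum.cong refl sum_shift[OF wV, where f = "\<lambda>d. ?P F (_ \<oplus> ?w s) d", symmetric])
    finally show ?thesis .
  qed
  have pt: "(\<Sum>s<p. \<Sum>t<p. ?P F (m \<oplus> ?w s) (d \<oplus> ?w t))
    = (real p)\<^sup>2 * ?P g m d - (1 - 1 / real p) * ?P u m d" if V: "m \<in> V n" "d \<in> V n" for m d
  proof -
    let ?H = "\<lambda>y z. (g m + u m * bump y) * (g (m \<oplus> d) + u (m \<oplus> d) * bump ((y + z) mod p)) *
      (g (m \<oplus> (d \<oplus> d)) + u (m \<oplus> (d \<oplus> d)) * bump ((y + (z + z) mod p) mod p))"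
    have "?P F (m \<oplus> ?w s) (d \<oplus> ?w t) = ?H ((m i + s * w i) mod p) ((d i + t * w i) mod p)" for s t
    proof -
      have c2: "((m \<oplus> ?w s) \<oplus> (d \<oplus> ?w t)) i = ((m i + s * w i) mod p + (d i + t * w i) mod p) mod p"
        unfolding coord[symmetric] by (simp add: vadd_def)
      have c3: "((m \<oplus> ?w s) \<oplus> ((d \<oplus> ?w t) \<oplus> (d \<oplus> ?w t))) i
        = ((m i + s * w i) mod p + ((d i + t * w i) mod p + (d i + t * w i) mod p) mod p) mod p"
        unfolding coord[symmetric] by (simp add: vadd_def)
      have r2: "(m \<oplus> ?w s) \<oplus> (d \<oplus> ?w t) = (m \<oplus> d) \<oplus> (?w s \<oplus> ?w t)" by (simp only: vadd_ac)
      have r3: "(m \<oplus> ?w s) \<oplus> ((d \<oplus> ?w t) \<oplus> (d \<oplus> ?w t)) = (m \<oplus> (d \<oplus> d)) \<oplus> (?w s \<oplus> (?w t \<oplus> ?w t))"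
        by (simp only: vadd_ac)
      have "F (m \<oplus> ?w s) = g m + u m * bump ((m i + s * w i) mod p)"
        unfolding F_def coord using V by (simp add: gu wR)
      moreover have "F ((m \<oplus> ?w s) \<oplus> (d \<oplus> ?w t)) = g (m \<oplus> d) + u (m \<oplus> d) *
          bump (((m i + s * w i) mod p + (d i + t * w i) mod p) mod p)"
        unfolding F_def c2 unfolding r2 using V by (simp add: gu wR ann_add)
      moreover have "F ((m \<oplus> ?w s) \<oplus> ((d \<oplus> ?w t) \<oplus> (d \<oplus> ?w t))) = g (m \<oplus> (d \<oplus> d)) + u (m \<oplus> (d \<oplus> d)) *
          bump (((m i + s * w i) mod p + ((d i + t * w i) mod p + (d i + t * w i) mod p) mod p) mod p)"
        unfolding F_def c3 unfolding r3 using V by (simp add: gu wR ann_add)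
      ultimately show ?thesis by simp
    qed
    then have "(\<Sum>s<p. \<Sum>t<p. ?P F (m \<oplus> ?w s) (d \<oplus> ?w t))
      = (\<Sum>s<p. \<Sum>t<p. ?H ((m i + s * w i) mod p) ((d i + t * w i) mod p))" by simp
    also have "\<dots> = (\<Sum>s<p. \<Sum>z<p. ?H ((m i + s * w i) mod p) z)"
      by (intro sum.cong refl sum_affine_reindex[OF wi])
    also have "\<dots> = (\<Sum>y<p. \<Sum>z<p. ?H y z)"
      by (rule sum_affine_reindex[OF wi, where H = "\<lambda>y. \<Sum>z<p. ?H y z"])
    finally show ?thesis unfolding sum_bump_product .
  qed
  have "(real p)\<^sup>2 * T n F F F = (\<Sum>s<p. \<Sum>t<p. T n F F F)" by (simp add: power2_eq_square)
  also have "\<dots> = (\<Sum>s<p. \<Sum>t<p. \<Sum>m\<in>V n. \<Sum>d\<in>V n. ?P F (m \<oplus> ?w s) (d \<oplus> ?w t))"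
    by (intro sum.cong refl shift)
  also have "\<dots> = (\<Sum>s<p. \<Sum>m\<in>V n. \<Sum>t<p. \<Sum>d\<in>V n. ?P F (m \<oplus> ?w s) (d \<oplus> ?w t))"
    by (intro sum.cong refl sum.swap)
  also have "\<dots> = (\<Sum>m\<in>V n. \<Sum>s<p. \<Sum>t<p. \<Sum>d\<in>V n. ?P F (m \<oplus> ?w s) (d \<oplus> ?w t))"
    by (rule sum.swap)
  also have "\<dots> = (\<Sum>m\<in>V n. \<Sum>s<p. \<Sum>d\<in>V n. \<Sum>t<p. ?P F (m \<oplus> ?w s) (d \<oplus> ?w t))"
    by (intro sum.cong refl sum.swap)
  also have "\<dots> = (\<Sum>m\<in>V n. \<Sum>d\<in>V n. \<Sum>s<p. \<Sum>t<p. ?P F (m \<oplus> ?w s) (d \<oplus> ?w t))"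
    by (intro sum.cong refl sum.swap)
  also have "\<dots> = (\<Sum>m\<in>V n. \<Sum>d\<in>V n. (real p)\<^sup>2 * ?P g m d - (1 - 1 / real p) * ?P u m d)"
    by (intro sum.cong refl pt)
  also have "\<dots> = (real p)\<^sup>2 * T n g g g - (1 - 1 / real p) * T n u u u"
    unfolding T_def by (simp only: sum_subtractf sum_distrib_left)
  finally show "T n F F F = T n g g g - (1 - 1 / real p) / (real p)\<^sup>2 * T n u u u"
    using p_pos by (simp add: field_simps)
qed

section \<open>From minimality to an approximate indicator function\<close>

lemma Lambda3_eq_T: "Lambda3 p n f = T n f f f / real p ^ (2 * n)"
  by (simp add: Lambda3_def T_def)

definition minimizer :: "real \<Rightarrow> nat \<Rightarrow> ((nat \<Rightarrow> nat) \<Rightarrow> real) \<Rightarrow> bool" where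
  "minimizer \<alpha> n f \<longleftrightarrow> (\<forall>x\<in>V n. 0 \<le> f x \<and> f x \<le> 1) \<and> Ex p n f \<ge> \<alpha> \<and>
    (\<forall>f'. (\<forall>x\<in>V n. 0 \<le> f' x \<and> f' x \<le> 1) \<and> Ex p n f' \<ge> \<alpha> \<longrightarrow> Lambda3 p n f \<le> Lambda3 p n f')"

text \<open>Here k bounds the codimension, expressed through the size of W; it is real so that it
  can later be e n.\<close>

definition near_indicator :: "nat \<Rightarrow> real \<Rightarrow> real \<Rightarrow> ((nat \<Rightarrow> nat) \<Rightarrow> real) \<Rightarrow> bool" where
  "near_indicator n k \<epsilon> f \<longleftrightarrow> (\<exists>W h. is_subgroup p n W \<and> real (card W) \<ge> real p powr (real n - k) \<and>
    (\<forall>x\<in>V n. h x \<in> {0, 1}) \<and> (\<forall>x\<in>V n. \<forall>w\<in>W. h (x \<oplus> w) = h x) \<and>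
    Ex p n (\<lambda>m. \<bar>f m - h m\<bar>) \<le> \<epsilon>)"

lemma near_indicator_mono:
  assumes "near_indicator n k \<epsilon> f" "k \<le> k'" "\<epsilon> \<le> \<epsilon>'"
  shows "near_indicator n k' \<epsilon>' f"
proof -
  have "real p powr (real n - k') \<le> real p powr (real n - k)"
    using p_gt_2 assms(2) by (intro powr_mono) auto
  moreover obtain W h where "is_subgroup p n W" "real p powr (real n - k) \<le> real (card W)"
    "\<forall>x\<in>V n. h x \<in> {0, 1}" "\<forall>x\<in>V n. \<forall>w\<in>W. h (x \<oplus> w) = h x" "Ex p n (\<lambda>m. \<bar>f m - h m\<bar>) \<le> \<epsilon>"
    using assms(1) unfolding near_indicator_def by blast
  ultimately show ?thesis
    unfolding near_indicator_def using assms(3) by (intro exI[of _ W] exI[of _ h]) auto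
qed

text \<open>The fallback for small n, with the whole space and h = 0; it keeps the set of admissible
  errors nonempty.\<close>

lemma near_indicator_trivial:
  assumes "\<forall>x\<in>V n. 0 \<le> f x \<and> f x \<le> 1"
  shows "near_indicator n (real n) 1 f"
proof -
  have "(\<Sum>x\<in>V n. \<bar>f x\<bar>) \<le> (\<Sum>x\<in>V n. 1)"
    using assms by (intro sum_mono) auto
  then have "Ex p n (\<lambda>m. \<bar>f m - 0\<bar>) \<le> 1" using p_pos by (simp add: Ex_def card_V divide_le_eq)
  then show ?thesis
    unfolding near_indicator_def using ann_subgroup[of n "{}"] ann_card_pos[of n "{}"] p_pos
    by (intro exI[of _ "ann n {}"] exI[of _ "\<lambda>_. 0"]) (auto simp: Suc_leI)
qed

lemma minimizer_near_indicator:
  assumes "0 < \<epsilon>"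
  shows "\<exists>K::nat. \<forall>n f. K < n \<longrightarrow> minimizer \<alpha> n f \<longrightarrow> near_indicator n (real K) \<epsilon> f"
proof -
  define q where "q = (1 - 1 / real p) / (real p)\<^sup>2"
  have "0 < q" using p_gt_2 by (simp add: q_def)
  obtain \<tau> where "\<tau> > 0" and \<tau>: "\<And>n f. \<forall>x\<in>V n. 0 \<le> f x \<and> f x \<le> 1 \<Longrightarrow>
      \<epsilon> * real p ^ n \<le> (\<Sum>x\<in>V n. f x) \<Longrightarrow> \<tau> * real p ^ n * real p ^ n \<le> T n f f f"
    using progressions_dense[OF assms] by metis
  \<comment> \<open>The loss 6\<delta> = q\<tau>/2 stays below the gain q\<tau> that a u of mean at
    least \<epsilon> would produce.\<close>
  define \<delta> where "\<delta> = q * \<tau> / 12"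
  have "0 < \<delta>" using \<open>0 < q\<close> \<open>\<tau> > 0\<close> by (simp add: \<delta>_def)
  define K where "K = nat \<lceil>1 / \<delta>\<^sup>2\<rceil>"
  show ?thesis
  proof (intro exI[of _ K] allI impI)
    fix n f
    assume n: "K < n" and "minimizer \<alpha> n f"
    then have f: "\<forall>x\<in>V n. 0 \<le> f x \<and> f x \<le> 1" and \<alpha>: "\<alpha> \<le> Ex p n f"
      and minimal: "\<And>f'. \<forall>x\<in>V n. 0 \<le> f' x \<and> f' x \<le> 1 \<Longrightarrow> \<alpha> \<le> Ex p n f' \<Longrightarrow> Lambda3 p n f \<le> Lambda3 p n f'"
      unfolding minimizer_def by blast+
    obtain R where R: "R \<subseteq> V n" "real (card R) \<le> 1 / \<delta>\<^sup>2"
      and Tdiff: "\<bar>T n f f f - T n (avg n R f) (avg n R f) (avg n R f)\<bar> \<le> 6 * \<delta> * real p ^ n * real p ^ n"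
      using obtain_uniform_avg[of n f \<delta> "{}"] f \<open>0 < \<delta>\<close> by auto
    have "finite R" using R(1) finite_subset finite_V by blast
    moreover have "card R \<le> K" using R(2) unfolding K_def by linarith
    ultimately have dens: "real p ^ n / real p ^ K \<le> real (card (ann n R))" by (rule ann_density)
    \<comment> \<open>For n > K the annihilator is nontrivial, which supplies the coordinate
      i.\<close>
    have "1 < real p ^ (n - K)" using n p_gt_2 by (intro one_less_power) auto
    also have "\<dots> = real p ^ n / real p ^ K" using n p_pos by (simp add: power_diff)
    also note dens
    finally have "ann n R \<noteq> {\<lambda>_. 0}" by auto
    then obtain w where "w \<in> ann n R" "w \<noteq> (\<lambda>_. 0)" using ann_zero[of n R] by blast
    then obtain i where w: "w \<in> ann n R" "w i \<noteq> 0" by blast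
    define g where "g = avg n R f"
    \<comment> \<open>The largest amplitude for which both g + u and g - u stay in [0, 1]; since
      \<open>bump\<close> is at most 1 in absolute value, F does too.\<close>
    define u where "u x = min (g x) (1 - g x)" for x
    define F where "F x = g x + u x * bump (x i)" for x
    define h where "h x = (if g x \<ge> 1 / 2 then 1 else 0 :: real)" for x
    have g: "0 \<le> g x \<and> g x \<le> 1" if "x \<in> V n" for x
      using avg_bounds f that by (auto simp: g_def)
    have u: "\<forall>x\<in>V n. 0 \<le> u x \<and> u x \<le> 1" using g by (auto simp: u_def)
    have ginv: "invariant n R g" unfolding g_def by (rule avg_invariant)
    then have uinv: "invariant n R u" and hinv: "invariant n R h"
      unfolding invariant_def u_def h_def by auto
    note P = perturb[OF w ginv uinv, folded F_def q_def]
    have "\<bar>u x * bump (x i)\<bar> \<le> u x" if "x \<in> V n" for x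
    proof -
      have "\<bar>bump (x i)\<bar> \<le> 1" using p_gt_2 by (auto simp: bump_def abs_le_iff divide_simps)
      then show ?thesis using mult_left_le[of "\<bar>bump (x i)\<bar>" "u x"] u that by (simp add: abs_mult)
    qed
    then have "\<forall>x\<in>V n. 0 \<le> F x \<and> F x \<le> 1"
      unfolding F_def abs_le_iff by (fastforce simp: u_def min_def split: if_splits)
    moreover have "Ex p n F = Ex p n f" unfolding Ex_def P(1) by (simp add: g_def avg_sum)
    ultimately have "Lambda3 p n f \<le> Lambda3 p n F" using minimal \<alpha> by simp
    then have "T n f f f \<le> T n F F F"
      using p_pos unfolding Lambda3_eq_T by (simp add: divide_le_cancel)
    also have "\<dots> = T n g g g - q * T n u u u" by (rule P(2))
    finally have "q * T n u u u \<le> 6 * \<delta> * real p ^ n * real p ^ n"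
      using Tdiff unfolding g_def by linarith
    also have "\<dots> < q * (\<tau> * real p ^ n * real p ^ n)"
      using \<open>0 < q\<close> \<open>\<tau> > 0\<close> p_pos by (simp add: \<delta>_def)
    finally have "T n u u u < \<tau> * real p ^ n * real p ^ n" using \<open>0 < q\<close> by simp
    then have small: "(\<Sum>x\<in>V n. u x) < \<epsilon> * real p ^ n" using \<tau>[OF u] by force
    \<comment> \<open>As h is 0 or 1 and f lies in [0, 1], this distance is affine in f with
      coefficients constant on cosets. Averaging may thus replace f by g, and |g - h| is u.\<close>
    have hd: "\<bar>f x - h x\<bar> = f x * (1 - 2 * h x) + h x" if "x \<in> V n" for x
      using f that by (auto simp: h_def)
    have ud: "u x = g x * (1 - 2 * h x) + h x" for x
      by (auto simp: h_def u_def)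
    have "(\<Sum>x\<in>V n. \<bar>f x - h x\<bar>) = (\<Sum>x\<in>V n. f x * (1 - 2 * h x)) + (\<Sum>x\<in>V n. h x)"
      by (simp add: hd sum.distrib)
    also have "(\<Sum>x\<in>V n. f x * (1 - 2 * h x)) = (\<Sum>x\<in>V n. g x * (1 - 2 * h x))"
      unfolding g_def using hinv by (intro avg_adjoint[symmetric]) (simp add: invariant_def)
    also have "\<dots> + (\<Sum>x\<in>V n. h x) = (\<Sum>x\<in>V n. u x)" by (simp add: ud sum.distrib)
    finally have "Ex p n (\<lambda>m. \<bar>f m - h m\<bar>) \<le> \<epsilon>"
      using small p_pos by (simp add: Ex_def divide_le_eq)
    moreover have "real p powr (real n - real K) \<le> real (card (ann n R))"
      using dens p_pos by (simp add: powr_diff powr_realpow)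
    moreover have "\<forall>x\<in>V n. h x \<in> {0, 1}" by (simp add: h_def)
    ultimately show "near_indicator n (real K) \<epsilon> f"
      using ann_subgroup[of n R] hinv unfolding invariant_def near_indicator_def by blast
  qed
qed

end

theorem theorem2:
  fixes p :: nat and \<alpha> :: real
  assumes "prime p" and "odd p" and "0 < \<alpha>" and "\<alpha> \<le> 1"
  shows "\<exists>a c :: nat \<Rightarrow> real. a \<longlonglongrightarrow> 0 \<and> c \<longlonglongrightarrow> 0 \<and>
    (\<forall>n f. (\<forall>x\<in>Fpn p n. 0 \<le> f x \<and> f x \<le> 1) \<and> Ex p n f \<ge> \<alpha> \<and>
       (\<forall>f'. (\<forall>x\<in>Fpn p n. 0 \<le> f' x \<and> f' x \<le> 1) \<and> Ex p n f' \<ge> \<alpha> \<longrightarrow>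
              Lambda3 p n f \<le> Lambda3 p n f')
     \<longrightarrow> (\<exists>W h. is_subgroup p n W \<and>
            real (card W) \<ge> real p powr (real n - a n * real n) \<and>
            (\<forall>x\<in>Fpn p n. h x \<in> {0, 1}) \<and>
            (\<forall>x\<in>Fpn p n. \<forall>w\<in>W. h (vadd p x w) = h x) \<and>
            Ex p n (\<lambda>m. \<bar>f m - h m\<bar>) \<le> c n))"
proof -
  interpret odd_prime p using assms by unfold_locales
  \<comment> \<open>One parameter e governs both the relative codimension and the L1 error, so a
    single sequence serves as a and as c.\<close>
  define Q where "Q n e \<longleftrightarrow> (\<forall>f. minimizer \<alpha> n f \<longrightarrow> near_indicator n (e * real n) e f)" for n e
  have "\<exists>c. c \<longlonglongrightarrow> 0 \<and> (\<forall>n. Q n (c n))"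
  proof (rule exists_null_sequence)
    show "Q n 1" for n
      unfolding Q_def using near_indicator_trivial by (auto simp: minimizer_def)
  next
    fix n and e e' :: real
    assume "Q n e" "e \<le> e'"
    then show "Q n e'"
      unfolding Q_def by (meson near_indicator_mono mult_right_mono of_nat_0_le_iff)
  next
    fix e :: real
    assume "0 < e"
    then obtain K where K: "\<And>n f. K < n \<Longrightarrow> minimizer \<alpha> n f \<Longrightarrow> near_indicator n (real K) e f"
      using minimizer_near_indicator by metis
    have "Q n e" if n: "n > max K (nat \<lceil>real K / e\<rceil>)" for n
    proof -
      have "real K / e \<le> real n" using n by linarith
      then have "real K \<le> e * real n" using \<open>0 < e\<close> by (simp add: field_simps)
      then show ?thesis
        unfolding Q_def using K n by (meson near_indicator_mono max.strict_boundedE order_refl)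
    qed
    then show "\<forall>\<^sub>F n in sequentially. Q n e"
      unfolding eventually_at_top_dense by blast
  qed
  then obtain c where c: "c \<longlonglongrightarrow> 0" "\<And>n. Q n (c n)" by blast
  then show ?thesis
    unfolding Q_def minimizer_def near_indicator_def by (intro exI[of _ c]) simp
qed

end
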